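(* Let $g\in L^\infty(U)$ satisfy $\|g\|_\infty<\frac1{l_0}\left(\frac1{2^pK}\right)^{\frac1{p-1}}$, where $K=l_0\,p\,\|b\|_\infty$. Let $\{\mu_j\}_{j\in\mathbb{N}}$ be a sequence in $\mathcal{M}(U)$ and let $\{a_j(\omega)\}_{j\in\mathbb{N}}$ be a sequence of random variables from $\Omega$ to $\mathbb{R}$. Assume that the series $$\mu_\omega=\sum_{j=1}^\infty a_j(\omega)\mu_j$$ is convergent in $\mathcal{M}(U)$. For $k\in\mathbb{N}$ define $S_k(\omega)=\sum_{j=1}^k a_j(\omega)\mu_j$ and $L_k=\{\omega\in\Omega:\ |S_k(\omega)|\ge\tilde c\}$, with $0<\tilde c<1/(l_0\|f\|_\infty)$. If $$\sum_{k=1}^\infty\mathbb{P}(L_k)<\infty,$$ then, almost surely in $\Omega$, there is an integral solution of $$-\Delta u+V_\omega(x)u=b(x)u|u|^{p-1}+g(x)\ \text{ in }U,\qquad u=0\ \text{ on }\partial U.$$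
   Context: Let $n\ge3$, $p>1$, and let $U\subset\mathbb{R}^n$ be a bounded domain with diameter $d_U$; put $l_0:=\frac{d_U^2}{2(n-2)}$. $(\Omega,\mathcal{F},\mathbb{P})$ is a complete probability space. $\mathcal{M}(U)$ is the space of (signed) Radon measures on $U$ of finite total variation, with total variation norm denoted $|\mu|$ (convergence in $\mathcal{M}(U)$ is in this norm). $f\in BC(\mathbb{R}^n)$ (bounded continuous real functions) and $b\in L^\infty(U)$ are fixed, both nonzero, with $\|f\|_\infty:=\sup_{\mathbb{R}^n}|f|$ and $\|\cdot\|_\infty$ the essential supremum norm on $L^\infty(U)$. The random potential is $V_\omega(x):=\int_U f(x-y)\,d\mu_\omega(y)$, $x\in U$. $G$ is the Green function of $-\Delta$ in $U$ with zero Dirichlet boundary condition, which satisfies $0\le G(x,y)\le\frac{1}{n\alpha_n(n-2)}|x-y|^{2-n}$ ($\alpha_n$ = volume of the unit ball of $\mathbb{R}^n$), and $H(\varphi)(x):=\int_U G(x,y)\varphi(y)\,dy$ for $\varphi\in L^\infty(U)$. An integral solution of the problem is a function $u\in L^\infty(U)$ satisfying $u=H(g)-H(V_\omega u)+H(bu|u|^{p-1})$. *)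

theory Defs
  imports "HOL-Probability.Probability" "HOL-Probability.Essential_Supremum"
begin

subsection \<open>The space of essentially bounded functions\<close>

definition linf_norm :: "'a::euclidean_space set \<Rightarrow> ('a \<Rightarrow> real) \<Rightarrow> real"
  where "linf_norm U u = real_of_ereal (esssup (lebesgue_on U) (\<lambda>x. ereal \<bar>u x\<bar>))"

definition linf_space :: "'a::euclidean_space set \<Rightarrow> ('a \<Rightarrow> real) set"
  where "linf_space U = {u \<in> borel_measurable (lebesgue_on U).
           esssup (lebesgue_on U) (\<lambda>x. ereal \<bar>u x\<bar>) < \<infinity>}"

subsection \<open>Signed Radon measures\<close>

text \<open>A signed measure on \<open>U\<close> is a real-valued set function, of which only the values on the
  Borel subsets of \<open>U\<close> matter.\<close>

definition variation :: "('a::euclidean_space set \<Rightarrow> real) \<Rightarrow> 'a set \<Rightarrow> ennreal"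
  where "variation \<nu> E =
    (SUP P \<in> {P. finite P \<and> P \<subseteq> sets borel \<and> partition_on E P}. \<Sum>A\<in>P. ennreal \<bar>\<nu> A\<bar>)"

definition countably_additive_on :: "'a::euclidean_space set \<Rightarrow> ('a set \<Rightarrow> real) \<Rightarrow> bool"
  where "countably_additive_on U \<nu> \<longleftrightarrow> \<nu> {} = 0 \<and>
    (\<forall>A::nat \<Rightarrow> 'a set. range A \<subseteq> sets (restrict_space borel U) \<and> disjoint_family A \<longrightarrow>
       (\<lambda>i. \<nu> (A i)) sums \<nu> (\<Union>i. A i))"

definition radon_measures :: "'a::euclidean_space set \<Rightarrow> ('a set \<Rightarrow> real) set"
  where "radon_measures U = {\<nu>. countably_additive_on U \<nu> \<and> variation \<nu> U < \<infinity> \<and>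
    (\<forall>E \<in> sets (restrict_space borel U). \<forall>e>0. \<exists>C. compact C \<and> C \<subseteq> E \<and> variation \<nu> (E - C) < e)}"

text \<open>The Jordan decomposition: the positive part of \<open>\<nu>\<close> maps \<open>E\<close> to the supremum of \<open>\<nu> A\<close>
  over the Borel sets \<open>A \<subseteq> E\<close>. Here \<open>ennreal\<close> truncates negative values to 0, which does not
  affect the supremum since \<open>\<nu> {} = 0\<close>. The negative part of \<open>\<nu>\<close> is the positive part of \<open>-\<nu>\<close>.\<close>

definition positive_part :: "'a::euclidean_space set \<Rightarrow> ('a set \<Rightarrow> real) \<Rightarrow> 'a measure"
  where "positive_part U \<nu> = measure_of U (sets (restrict_space borel U))
    (\<lambda>E. SUP A \<in> {A \<in> sets borel. A \<subseteq> E}. ennreal (\<nu> A))"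

definition signed_integral ::
    "'a::euclidean_space set \<Rightarrow> ('a set \<Rightarrow> real) \<Rightarrow> ('a \<Rightarrow> real) \<Rightarrow> real"
  where "signed_integral U \<nu> \<phi> =
    (LINT y|positive_part U \<nu>. \<phi> y) - (LINT y|positive_part U (\<lambda>A. - \<nu> A). \<phi> y)"

definition potential ::
    "'a::euclidean_space set \<Rightarrow> ('a \<Rightarrow> real) \<Rightarrow> ('a set \<Rightarrow> real) \<Rightarrow> 'a \<Rightarrow> real"
  where "potential U f \<nu> x = signed_integral U \<nu> (\<lambda>y. f (x - y))"

definition partial_sum ::
    "(nat \<Rightarrow> 'w \<Rightarrow> real) \<Rightarrow> (nat \<Rightarrow> 'a set \<Rightarrow> real) \<Rightarrow> nat \<Rightarrow> 'w \<Rightarrow> 'a set \<Rightarrow> real"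
  where "partial_sum a \<mu> k \<omega> = (\<lambda>A. \<Sum>j=1..k. a j \<omega> * \<mu> j A)"

subsection \<open>The Dirichlet Green function\<close>

text \<open>\<open>harmonic_on h S\<close> is meant for open \<open>S\<close>: \<open>h\<close> is twice continuously differentiable with
  gradient \<open>D\<close> and Hessian \<open>D2\<close>, and the trace of the Hessian vanishes.\<close>

definition harmonic_on :: "('a::euclidean_space \<Rightarrow> real) \<Rightarrow> 'a set \<Rightarrow> bool"
  where "harmonic_on h S \<longleftrightarrow> (\<exists>(D :: 'a \<Rightarrow> 'a) (D2 :: 'a \<Rightarrow> 'a \<Rightarrow>\<^sub>L 'a).
    (\<forall>x\<in>S. (h has_derivative (\<lambda>v. D x \<bullet> v)) (at x)) \<and>
    (\<forall>x\<in>S. (D has_derivative blinfun_apply (D2 x)) (at x)) \<and>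
    continuous_on S D2 \<and>
    (\<forall>x\<in>S. (\<Sum>e\<in>Basis. blinfun_apply (D2 x) e \<bullet> e) = 0))"

definition subharmonic_on :: "('a::euclidean_space \<Rightarrow> real) \<Rightarrow> 'a set \<Rightarrow> bool"
  where "subharmonic_on s U \<longleftrightarrow> continuous_on U s \<and>
    (\<forall>x r h. 0 < r \<and> cball x r \<subseteq> U \<and> continuous_on (cball x r) h \<and> harmonic_on h (ball x r) \<and>
       (\<forall>z\<in>sphere x r. s z \<le> h z) \<longrightarrow> (\<forall>z\<in>ball x r. s z \<le> h z))"

text \<open>Perron's solution of the Dirichlet problem in \<open>U\<close> with boundary values \<open>\<phi>\<close>. It is defined
  for every bounded domain and is the classical solution whenever the latter exists.\<close>

definition perron_solution :: "'a::euclidean_space set \<Rightarrow> ('a \<Rightarrow> real) \<Rightarrow> 'a \<Rightarrow> real"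
  where "perron_solution U \<phi> x =
    (SUP s \<in> {s. continuous_on (closure U) s \<and> subharmonic_on s U \<and> (\<forall>z\<in>frontier U. s z \<le> \<phi> z)}. s x)"

definition fundamental_solution :: "'a::euclidean_space \<Rightarrow> real"
  where "fundamental_solution z =
    1 / (real DIM('a) * unit_ball_vol (real DIM('a)) * (real DIM('a) - 2)) *
      norm z powr (2 - real DIM('a))"

text \<open>The Green function is the fundamental solution with pole \<open>y\<close>, corrected by the harmonic
  function with the same boundary values. No boundary regularity of \<open>U\<close> is assumed, so the
  correction is taken in the sense of Perron. The value on the diagonal is irrelevant.\<close>

definition green :: "'a::euclidean_space set \<Rightarrow> 'a \<Rightarrow> 'a \<Rightarrow> real"
  where "green U x y =
    fundamental_solution (x - y) - perron_solution U (\<lambda>z. fundamental_solution (z - y)) x"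

definition green_operator :: "'a::euclidean_space set \<Rightarrow> ('a \<Rightarrow> real) \<Rightarrow> 'a \<Rightarrow> real"
  where "green_operator U \<phi> x = (LINT y|lebesgue_on U. green U x y * \<phi> y)"

subsection \<open>Integral solutions\<close>

text \<open>Elements of \<open>linf_space U\<close> are functions rather than classes, so the equation is required
  almost everywhere in \<open>U\<close>.\<close>

definition integral_solution ::
    "'a::euclidean_space set \<Rightarrow> real \<Rightarrow> ('a \<Rightarrow> real) \<Rightarrow> ('a \<Rightarrow> real) \<Rightarrow> ('a \<Rightarrow> real) \<Rightarrow> ('a \<Rightarrow> real) \<Rightarrow> bool"
  where "integral_solution U p V b g u \<longleftrightarrow> u \<in> linf_space U \<and>
    (AE x in lebesgue_on U. u x = green_operator U g x - green_operator U (\<lambda>y. V y * u y) x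
       + green_operator U (\<lambda>y. b y * u y * \<bar>u y\<bar> powr (p - 1)) x)"

definition l0 :: "'a::euclidean_space set \<Rightarrow> real"
  where "l0 U = (diameter U)\<^sup>2 / (2 * (real DIM('a) - 2))"

end

theory Submission
  imports Defs
begin

text \<open>
  By Borel--Cantelli and convergence in total variation, almost surely \<open>|\<mu>\<^sub>\<omega>| \<le> c\<close>, so that
  \<open>l\<^sub>0 \<parallel>V\<^sub>\<omega>\<parallel> \<le> 1\<close>, and an integral solution is sought as a fixed point in a ball of
  \<open>L\<^sup>\<infinity>\<close>. The bound \<open>\<parallel>H\<parallel> \<le> l\<^sub>0\<close> is not enough for this: the smallness of \<open>g\<close> does not
  depend on the gap between \<open>l\<^sub>0 \<parallel>V\<^sub>\<omega>\<parallel>\<close> and 1. What makes the contraction work is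
  \<open>\<parallel>H\<parallel> \<le> l\<^sub>0 / 2\<close>: a set of diameter \<open>d\<close> lies in a ball of radius \<open>R\<close> with
  \<open>2 R\<^sup>2 \<le> d\<^sup>2\<close>, and by rearrangement the Newtonian potential of \<open>U\<close> is at most the central
  potential \<open>R\<^sup>2 / (2 (n - 2))\<close> of such a ball. Then the Picard iteration contracts with factor
  \<open>3/4\<close> on the ball of radius \<open>2 l\<^sub>0 \<parallel>g\<parallel>\<close>.
\<close>

section \<open>Harmonic and subharmonic functions\<close>

text \<open>The constants fit together as follows. Put L = \<open>l0 U\<close>, let \<Gamma> bound
  |g|, and let r = 2 L \<Gamma> be the radius of the ball. With H of norm at most L/2, the term H(g)
  is at most r/4, the linear term at most r/2 because L |V| <= 1, and the power term has Lipschitz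
  constant at most (L/2) |b| p r^(p-1) on the ball. Raising the hypothesis on g to the power p - 1
  gives K r^(p-1) <= 1/2, so this last constant is at most 1/4. Hence r/4 + r/2 + r/4 = r for the
  self-map and 1/2 + 1/4 = 3/4 for the contraction. The rearrangement bound concerns the Newtonian
  kernel; it passes to H through 0 <= G <= Newtonian kernel. The boundary of \<open>U\<close> may be
  irregular and G is given by a Perron supremum, so these inequalities are derived from comparison
  principles for harmonic and subharmonic functions, and the measurability of G from
  semicontinuity.\<close>

lemma harmonic_on_subset:
  assumes "harmonic_on h S" "T \<subseteq> S"
  shows "harmonic_on h T"
proof -
  obtain D D2 where D: "\<forall>x\<in>S. (h has_derivative (\<lambda>v. D x \<bullet> v)) (at x)"
    "\<forall>x\<in>S. (D has_derivative blinfun_apply (D2 x)) (at x)"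
    "continuous_on S D2" "\<forall>x\<in>S. (\<Sum>e\<in>Basis. blinfun_apply (D2 x) e \<bullet> e) = 0"
    using assms(1) unfolding harmonic_on_def by blast
  show ?thesis unfolding harmonic_on_def
    by (intro exI[of _ D] exI[of _ D2] conjI ballI continuous_on_subset[OF D(3) assms(2)])
      (use D assms(2) in \<open>auto simp: subset_iff\<close>)
qed

lemma harmonic_on_affine: "harmonic_on (\<lambda>x. a \<bullet> x + k) S"
  unfolding harmonic_on_def
  by (rule exI[of _ "\<lambda>_. a"], rule exI[of _ "\<lambda>_. 0"]) (auto intro!: derivative_eq_intros)

lemma harmonic_on_const: "harmonic_on (\<lambda>x. k) S"
  using harmonic_on_affine[of 0 k S] by simp

lemma harmonic_on_add:
  assumes "harmonic_on h S" "harmonic_on k S"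
  shows "harmonic_on (\<lambda>x. h x + k x) S"
proof -
  obtain D D2 where D: "\<forall>x\<in>S. (h has_derivative (\<lambda>v. D x \<bullet> v)) (at x)"
    "\<forall>x\<in>S. (D has_derivative blinfun_apply (D2 x)) (at x)"
    "continuous_on S D2" "\<forall>x\<in>S. (\<Sum>e\<in>Basis. blinfun_apply (D2 x) e \<bullet> e) = 0"
    using assms(1) unfolding harmonic_on_def by blast
  obtain E E2 where E: "\<forall>x\<in>S. (k has_derivative (\<lambda>v. E x \<bullet> v)) (at x)"
    "\<forall>x\<in>S. (E has_derivative blinfun_apply (E2 x)) (at x)"
    "continuous_on S E2" "\<forall>x\<in>S. (\<Sum>e\<in>Basis. blinfun_apply (E2 x) e \<bullet> e) = 0"
    using assms(2) unfolding harmonic_on_def by blast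
  have "((\<lambda>x. h x + k x) has_derivative (\<lambda>v. (D x + E x) \<bullet> v)) (at x)" if "x \<in> S" for x
    using has_derivative_add[OF D(1)[rule_format, OF that] E(1)[rule_format, OF that]]
    by (simp add: inner_add_left)
  moreover have "((\<lambda>x. D x + E x) has_derivative blinfun_apply (D2 x + E2 x)) (at x)" if "x \<in> S" for x
    using has_derivative_add[OF D(2)[rule_format, OF that] E(2)[rule_format, OF that]]
    by (simp add: plus_blinfun.rep_eq)
  moreover have "continuous_on S (\<lambda>x. D2 x + E2 x)"
    using D(3) E(3) by (intro continuous_intros)
  moreover have "(\<Sum>e\<in>Basis. blinfun_apply (D2 x + E2 x) e \<bullet> e) = 0" if "x \<in> S" for x
    using D(4) E(4) that by (simp add: blinfun.add_left inner_add_left sum.distrib)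
  ultimately show ?thesis unfolding harmonic_on_def
    by (intro exI[of _ "\<lambda>x. D x + E x"] exI[of _ "\<lambda>x. D2 x + E2 x"] conjI ballI)
qed

text \<open>The kernel is treated as a power of the polynomial \<open>w\<close>, the squared
  distance to the pole. Its Hessian is a multiple of the identity minus \<open>n / w\<close> times
  the rank-one form of \<open>z - y\<close>; both have trace \<open>n\<close>.\<close>

lemma harmonic_on_fundamental_solution:
  fixes y :: "'a::euclidean_space"
  shows "harmonic_on (\<lambda>z. fundamental_solution (z - y)) (- {y})"
proof -
  define n where "n = real DIM('a)"
  define C where "C = 1 / (n * unit_ball_vol n * (n - 2))"
  define w where "w = (\<lambda>z::'a. (z - y) \<bullet> (z - y))"
  define D where "D = (\<lambda>z. (C * (2 - n) * w z powr (- n / 2)) *\<^sub>R (z - y))"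
  define D2 where "D2 = (\<lambda>z v. (C * (2 - n)) *\<^sub>R (w z powr (- n / 2) *\<^sub>R v
      - (n * w z powr (- n / 2 - 1) * ((z - y) \<bullet> v)) *\<^sub>R (z - y)))"
  have wpos: "w z > 0" if "z \<noteq> y" for z using that by (simp add: w_def)
  have wd: "(w has_derivative (\<lambda>v. 2 * ((z - y) \<bullet> v))) (at z)" for z
    unfolding w_def by (auto intro!: derivative_eq_intros simp: inner_commute)
  have wp: "((\<lambda>z. w z powr m) has_derivative (\<lambda>v. m * w z powr (m - 1) * (2 * ((z - y) \<bullet> v)))) (at z)"
    if "z \<noteq> y" for z m
    using has_derivative_compose[OF wd, of "\<lambda>t. t powr m" "\<lambda>v. m * w z powr (m - 1) * v" z]
      has_real_derivative_powr[OF wpos[OF that], of m]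
    by (simp add: has_field_derivative_def)
  have fs: "fundamental_solution (z - y) = C * w z powr ((2 - n) / 2)" for z
    unfolding fundamental_solution_def C_def n_def w_def norm_eq_sqrt_inner
    by (simp add: powr_half_sqrt[symmetric] powr_powr)
  have bl: "bounded_linear (D2 z)" for z
    unfolding D2_def by (intro bounded_linear_intros)
  have ap: "blinfun_apply (Blinfun (D2 z)) = D2 z" for z
    using bl by (rule bounded_linear_Blinfun_apply)
  show ?thesis
    unfolding harmonic_on_def
  proof (intro exI[of _ D] exI[of _ "\<lambda>z. Blinfun (D2 z)"] conjI ballI)
    fix z assume "z \<in> - {y}" then have z: "z \<noteq> y" by simp
    have "((\<lambda>z. C * w z powr ((2 - n) / 2)) has_derivative
        (\<lambda>v. C * ((2 - n) / 2 * w z powr ((2 - n) / 2 - 1) * (2 * ((z - y) \<bullet> v))))) (at z)"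
      by (intro has_derivative_mult_right wp z)
    moreover have "(2 - n) / 2 - 1 = - n / 2" by (simp add: field_simps)
    moreover have "(\<lambda>v. C * ((2 - n) / 2 * w z powr (- n / 2) * (2 * ((z - y) \<bullet> v)))) = (\<lambda>v. D z \<bullet> v)"
      unfolding D_def by (rule ext) simp
    ultimately show "((\<lambda>z. fundamental_solution (z - y)) has_derivative (\<lambda>v. D z \<bullet> v)) (at z)"
      unfolding fs by simp
    show "(D has_derivative blinfun_apply (Blinfun (D2 z))) (at z)"
      unfolding ap
    proof -
      have "(D has_derivative (\<lambda>v. (C * (2 - n) * w z powr (- n / 2)) *\<^sub>R v
          + (C * (2 - n) * (- n / 2 * w z powr (- n / 2 - 1) * (2 * ((z - y) \<bullet> v)))) *\<^sub>R (z - y))) (at z)"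
        unfolding D_def
        by (intro has_derivative_scaleR has_derivative_mult_right wp z) (auto intro!: derivative_eq_intros)
      also have "(\<lambda>v. (C * (2 - n) * w z powr (- n / 2)) *\<^sub>R v
          + (C * (2 - n) * (- n / 2 * w z powr (- n / 2 - 1) * (2 * ((z - y) \<bullet> v)))) *\<^sub>R (z - y)) = D2 z"
        unfolding D2_def by (rule ext) (simp add: scaleR_diff_right mult.assoc)
      finally show "(D has_derivative D2 z) (at z)" .
    qed
    have "(\<Sum>e\<in>Basis. D2 z e \<bullet> e) = (\<Sum>e\<in>Basis. C * (2 - n) * w z powr (- n / 2)
        - C * (2 - n) * n * w z powr (- n / 2 - 1) * (((z - y) \<bullet> e) * ((z - y) \<bullet> e)))"
      by (intro sum.cong refl)
        (simp add: D2_def inner_diff_left[of "_ *\<^sub>R _"] inner_scaleR_left inner_same_Basis right_diff_distrib mult.assoc del: inner_diff_left)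
    also have "\<dots> = n * (C * (2 - n) * w z powr (- n / 2))
        - C * (2 - n) * n * w z powr (- n / 2 - 1) * (\<Sum>e\<in>Basis. ((z - y) \<bullet> e) * ((z - y) \<bullet> e))"
      unfolding sum_subtractf sum_distrib_left[symmetric] sum_constant n_def by simp
    also have "(\<Sum>e\<in>Basis. ((z - y) \<bullet> e) * ((z - y) \<bullet> e)) = w z"
      unfolding w_def euclidean_inner[of "z - y" "z - y"] ..
    also have "w z powr (- n / 2 - 1) = w z powr (- n / 2) / w z"
      using wpos[OF z] by (simp add: powr_diff)
    finally show "(\<Sum>e\<in>Basis. blinfun_apply (Blinfun (D2 z)) e \<bullet> e) = 0"
      using wpos[OF z] by (simp add: ap)
  next
    show "continuous_on (- {y}) (\<lambda>z. Blinfun (D2 z))"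
    proof (rule continuous_on_blinfun_componentwise)
      fix i :: 'a
      have cw: "continuous_on (- {y}) w" unfolding w_def by (intro continuous_intros)
      show "continuous_on (- {y}) (\<lambda>z. blinfun_apply (Blinfun (D2 z)) i)"
        unfolding ap unfolding D2_def
        by (intro continuous_intros cw) (auto simp: w_def)
    qed
  qed
qed

text \<open>Weak minimum principle. Subtracting a small multiple of the squared distance to the
  centre forces a minimum inside the ball. Since the Hessian of \<open>h\<close> has trace 0, some
  coordinate direction has nonpositive second derivative, which the subtraction makes strictly
  negative: impossible at a minimum.\<close>

lemma harmonic_on_ge_boundary:
  fixes x :: "'a::euclidean_space"
  assumes h: "harmonic_on h (ball x r)" and cont: "continuous_on (cball x r) h" and r: "r > 0"
    and bd: "\<And>z. z \<in> sphere x r \<Longrightarrow> k \<le> h z" and z1: "z1 \<in> ball x r"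
  shows "k \<le> h z1"
proof (rule ccontr)
  assume "\<not> k \<le> h z1"
  then have neg: "h z1 < k" by simp
  obtain D D2 where D: "\<forall>x\<in>ball x r. (h has_derivative (\<lambda>v. D x \<bullet> v)) (at x)"
    "\<forall>x\<in>ball x r. (D has_derivative blinfun_apply (D2 x)) (at x)"
    "\<forall>x\<in>ball x r. (\<Sum>e\<in>Basis. blinfun_apply (D2 x) e \<bullet> e) = 0"
    using h unfolding harmonic_on_def by blast
  \<comment> \<open>On the sphere the subtracted term is half the gap \<open>k - h z1\<close>, too
    little to move the minimum there.\<close>
  define \<epsilon> where "\<epsilon> = (k - h z1) / (2 * r\<^sup>2)"
  have \<epsilon>: "\<epsilon> > 0" using neg r by (simp add: \<epsilon>_def)
  have \<epsilon>r: "\<epsilon> * r\<^sup>2 < k - h z1" using neg r by (simp add: \<epsilon>_def)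
  define \<psi> where "\<psi> = (\<lambda>z. h z - \<epsilon> * ((z - x) \<bullet> (z - x)))"
  have "continuous_on (cball x r) \<psi>" unfolding \<psi>_def by (intro continuous_intros cont)
  then obtain z0 where z0: "z0 \<in> cball x r" "\<And>z. z \<in> cball x r \<Longrightarrow> \<psi> z0 \<le> \<psi> z"
    using continuous_attains_inf[of "cball x r" \<psi>] r by (metis cball_eq_empty compact_cball not_less order_less_imp_le)
  have "\<psi> z0 \<le> \<psi> z1" using z0(2) z1 by simp
  also have "\<dots> \<le> h z1" using \<epsilon> by (simp add: \<psi>_def)
  finally have lt: "\<psi> z0 \<le> h z1" .
  have z0b: "z0 \<in> ball x r"
  proof (rule ccontr)
    assume "z0 \<notin> ball x r"
    then have s: "z0 \<in> sphere x r" using z0(1) by (simp add: not_less)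
    then have "(z0 - x) \<bullet> (z0 - x) = r\<^sup>2"
      by (simp add: dot_square_norm dist_norm norm_minus_commute)
    then have "\<psi> z0 \<ge> k - \<epsilon> * r\<^sup>2" using bd[OF s] by (simp add: \<psi>_def)
    with lt \<epsilon>r show False by linarith
  qed
  have "\<exists>e\<in>Basis. blinfun_apply (D2 z0) e \<bullet> e \<le> 0"
  proof (rule ccontr)
    assume "\<not> ?thesis"
    then have "(\<Sum>e\<in>Basis. blinfun_apply (D2 z0) e \<bullet> e) > 0"
      by (intro sum_pos) (auto simp: not_le)
    with D(3) z0b show False by force
  qed
  then obtain e where e: "e \<in> Basis" "blinfun_apply (D2 z0) e \<bullet> e \<le> 0" by blast
  obtain \<delta> where \<delta>: "\<delta> > 0" "ball z0 \<delta> \<subseteq> ball x r"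
    using z0b open_ball[of x r] open_contains_ball by blast
  have mem: "z0 + t *\<^sub>R e \<in> ball x r" if "\<bar>t\<bar> < \<delta>" for t
    using that \<delta>(2) e(1) by (auto simp: subset_iff dist_norm)
  define \<phi> where "\<phi> = (\<lambda>t. \<psi> (z0 + t *\<^sub>R e))"
  define \<phi>' where "\<phi>' = (\<lambda>t. D (z0 + t *\<^sub>R e) \<bullet> e - 2 * \<epsilon> * ((z0 + t *\<^sub>R e - x) \<bullet> e))"
  have line: "((\<lambda>t. z0 + t *\<^sub>R e) has_derivative (\<lambda>t. t *\<^sub>R e)) (at t)" for t :: real
    by (auto intro!: derivative_eq_intros)
  have d1: "(\<phi> has_real_derivative \<phi>' t) (at t)" if t: "\<bar>t\<bar> < \<delta>" for t
  proof -
    have "((\<lambda>t. h (z0 + t *\<^sub>R e)) has_derivative (\<lambda>s. D (z0 + t *\<^sub>R e) \<bullet> (s *\<^sub>R e))) (at t)"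
      using has_derivative_compose[OF line D(1)[rule_format, OF mem[OF t]]] .
    then show ?thesis
      unfolding \<phi>_def \<psi>_def \<phi>'_def has_field_derivative_def
      by (auto intro!: derivative_eq_intros simp: algebra_simps inner_commute fun_eq_iff)
  qed
  have d2: "(\<phi>' has_real_derivative (blinfun_apply (D2 z0) e \<bullet> e - 2 * \<epsilon>)) (at 0)"
  proof -
    have "((\<lambda>t. D (z0 + t *\<^sub>R e)) has_derivative (\<lambda>s. blinfun_apply (D2 (z0 + 0 *\<^sub>R e)) (s *\<^sub>R e))) (at 0)"
      using has_derivative_compose[OF line D(2)[rule_format, OF mem[of 0]]] \<delta>(1) by simp
    then show ?thesis
      unfolding \<phi>'_def has_field_derivative_def using e(1)
      by (auto intro!: derivative_eq_intros
          simp: algebra_simps inner_commute fun_eq_iff blinfun.scaleR_right)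
  qed
  have min: "\<phi> 0 \<le> \<phi> t" if "\<bar>t\<bar> < \<delta>" for t
    using z0(2)[of "z0 + t *\<^sub>R e"] mem[OF that] by (simp add: \<phi>_def)
  have zero: "\<phi>' 0 = 0"
    by (rule DERIV_local_min[OF d1 \<delta>(1)]) (use \<delta> min in auto)
  obtain \<eta> where \<eta>: "\<eta> > 0" "\<And>t. 0 < t \<Longrightarrow> t < \<eta> \<Longrightarrow> \<phi>' t < 0"
    using DERIV_neg_dec_right[OF d2] e(2) \<epsilon> zero by auto
  define t where "t = min \<delta> \<eta> / 2"
  have t: "0 < t" "t < \<delta>" "t < \<eta>" using \<delta> \<eta> by (auto simp: t_def min_def)
  have "\<phi> t < \<phi> 0"
  proof (rule DERIV_neg_imp_decreasing_open[OF t(1)])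
    show "\<exists>y. DERIV \<phi> s :> y \<and> y < 0" if "0 < s" "s < t" for s
      using d1[of s] \<eta>(2)[of s] that t by force
    show "continuous_on {0..t} \<phi>"
      by (intro DERIV_continuous_on[where D=\<phi>'] DERIV_subset[OF d1]) (use t in auto)
  qed
  with min[of t] t show False by simp
qed

section \<open>Subharmonic functions and the comparison principle on bounded open sets\<close>

lemma subharmonic_on_const: "subharmonic_on (\<lambda>_. k) U"
  unfolding subharmonic_on_def
proof (intro conjI allI impI ballI)
  fix x r h z
  assume *: "0 < r \<and> cball x r \<subseteq> U \<and> continuous_on (cball x r) h \<and> harmonic_on h (ball x r) \<and>
    (\<forall>z\<in>sphere x r. k \<le> h z)" and z: "z \<in> ball x r"
  show "k \<le> h z"
    by (rule harmonic_on_ge_boundary[OF _ _ _ _ z]) (use * in blast)+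
qed (rule continuous_on_const)

lemma subharmonic_onD:
  assumes "subharmonic_on s U" "0 < r" "cball x r \<subseteq> U" "continuous_on (cball x r) h"
    "harmonic_on h (ball x r)" "\<And>z. z \<in> sphere x r \<Longrightarrow> s z \<le> h z" "z \<in> ball x r"
  shows "s z \<le> h z"
  using assms(1)[unfolded subharmonic_on_def, THEN conjunct2, rule_format, of r x h z] assms(2-) by blast

lemma subharmonic_on_subset:
  assumes "subharmonic_on s U" "T \<subseteq> U"
  shows "subharmonic_on s T"
  unfolding subharmonic_on_def
proof (intro conjI allI impI)
  show "continuous_on T s"
    using assms continuous_on_subset unfolding subharmonic_on_def by blast
next
  fix x r h
  assume *: "0 < r \<and> cball x r \<subseteq> T \<and> continuous_on (cball x r) h \<and> harmonic_on h (ball x r) \<and>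
    (\<forall>z\<in>sphere x r. s z \<le> h z)"
  then have r: "0 < r" "cball x r \<subseteq> U" "continuous_on (cball x r) h" "harmonic_on h (ball x r)"
    and s: "\<And>z. z \<in> sphere x r \<Longrightarrow> s z \<le> h z"
    using assms(2) by blast+
  show "\<forall>z\<in>ball x r. s z \<le> h z"
    by (rule ballI) (rule subharmonic_onD[OF assms(1) r s])
qed

text \<open>Lets a competitor for one pole, lowered by a constant, compete for a nearby
  pole.\<close>

lemma subharmonic_on_diff_const:
  assumes "subharmonic_on s U"
  shows "subharmonic_on (\<lambda>x. s x - k) U"
  unfolding subharmonic_on_def
proof (intro conjI allI impI)
  show "continuous_on U (\<lambda>x. s x - k)"
    using assms by (auto simp: subharmonic_on_def intro!: continuous_intros)
  fix x r h
  assume *: "0 < r \<and> cball x r \<subseteq> U \<and> continuous_on (cball x r) h \<and> harmonic_on h (ball x r) \<and>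
    (\<forall>z\<in>sphere x r. s z - k \<le> h z)"
  then have r: "0 < r" "cball x r \<subseteq> U" and h: "continuous_on (cball x r) h" "harmonic_on h (ball x r)"
    and s: "\<And>z. z \<in> sphere x r \<Longrightarrow> s z \<le> h z + k"
    by (auto simp: algebra_simps)
  have c: "continuous_on (cball x r) (\<lambda>z. h z + k)" by (intro continuous_intros h)
  have "\<forall>z\<in>ball x r. s z \<le> h z + k"
    by (rule ballI) (rule subharmonic_onD[OF assms r c harmonic_on_add[OF h(2) harmonic_on_const] s])
  then show "\<forall>z\<in>ball x r. s z - k \<le> h z" by (simp add: algebra_simps)
qed

text \<open>Subharmonicity only provides comparison on balls, so the argument is localised at a
  maximum point \<open>x0\<close> of \<open>s - H\<close> plus a small multiple of the squared norm.
  On a sphere about \<open>x0\<close> the squared norm coincides with an affine function, hence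
  \<open>H\<close> plus an affine function is an admissible harmonic majorant there, yet it lies
  below \<open>s\<close> at \<open>x0\<close>.\<close>

lemma subharmonic_le_harmonic:
  fixes U :: "'a::euclidean_space set"
  assumes U: "open U" "bounded U"
    and s: "subharmonic_on s U" "continuous_on (closure U) s"
    and H: "harmonic_on H U" "continuous_on (closure U) H"
    and bd: "\<And>z. z \<in> frontier U \<Longrightarrow> s z \<le> H z" and x1: "x1 \<in> U"
  shows "s x1 \<le> H x1"
proof (rule ccontr)
  assume "\<not> s x1 \<le> H x1"
  then have pos: "s x1 - H x1 > 0" by simp
  obtain B where B: "B > 0" "\<And>x. x \<in> closure U \<Longrightarrow> norm x \<le> B"
    using bounded_closure[OF U(2)] unfolding bounded_pos by blast
  define \<epsilon> where "\<epsilon> = (s x1 - H x1) / (2 * B\<^sup>2)"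
  have \<epsilon>: "\<epsilon> > 0" "\<epsilon> * B\<^sup>2 < s x1 - H x1" using pos B by (auto simp: \<epsilon>_def)
  define w where "w = (\<lambda>x. s x - H x + \<epsilon> * (x \<bullet> x))"
  have "continuous_on (closure U) w" unfolding w_def by (intro continuous_intros s H)
  moreover have "compact (closure U)" using U by (simp add: compact_closure)
  moreover have "closure U \<noteq> {}" using x1 closure_subset by auto
  ultimately obtain x0 where x0: "x0 \<in> closure U" "\<And>x. x \<in> closure U \<Longrightarrow> w x \<le> w x0"
    using continuous_attains_sup[of "closure U" w] by blast
  have "x0 \<in> U"
  proof (rule ccontr)
    assume "x0 \<notin> U"
    then have "x0 \<in> frontier U" using x0(1) U by (simp add: frontier_def interior_open)
    then have "w x0 \<le> \<epsilon> * (x0 \<bullet> x0)" using bd by (simp add: w_def)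
    also have "x0 \<bullet> x0 \<le> B\<^sup>2"
      using B(2)[OF x0(1)] by (simp add: dot_square_norm power_mono)
    then have "\<epsilon> * (x0 \<bullet> x0) \<le> \<epsilon> * B\<^sup>2" using \<epsilon> by simp
    also have "\<dots> < s x1 - H x1" by (rule \<epsilon>)
    also have "\<dots> \<le> w x1" using \<epsilon> by (simp add: w_def)
    also have "\<dots> \<le> w x0" using x0(2) x1 closure_subset by blast
    finally show False by simp
  qed
  then obtain r where r: "r > 0" "cball x0 r \<subseteq> U" using U(1) open_contains_cball by blast
  have sub: "cball x0 r \<subseteq> closure U" using r closure_subset by blast
  \<comment> \<open>On the sphere this affine function equals
    \<open>w x0 - \<epsilon> * (x \<bullet> x)\<close>, so maximality of \<open>w\<close> at
    \<open>x0\<close> gives the majorant; at the centre it is smaller than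
    \<open>s x0 - H x0\<close> by \<open>\<epsilon> * r\<^sup>2\<close>.\<close>
  define l where "l = (\<lambda>x. (- 2 * \<epsilon>) *\<^sub>R x0 \<bullet> x + (s x0 - H x0 + 2 * \<epsilon> * (x0 \<bullet> x0) - \<epsilon> * r\<^sup>2))"
  have h: "harmonic_on (\<lambda>x. H x + l x) (ball x0 r)"
    unfolding l_def
    by (intro harmonic_on_add harmonic_on_affine harmonic_on_subset[OF H(1)]) (use r in \<open>auto simp: subset_iff\<close>)
  have c: "continuous_on (cball x0 r) (\<lambda>x. H x + l x)"
    unfolding l_def by (intro continuous_intros continuous_on_subset[OF H(2) sub])
  have sp: "s x \<le> H x + l x" if "x \<in> sphere x0 r" for x
  proof -
    have "w x \<le> w x0" using x0(2) sub that by auto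
    moreover have "(x - x0) \<bullet> (x - x0) = r\<^sup>2" using that
      by (simp add: dot_square_norm dist_norm norm_minus_commute)
    then have "x \<bullet> x = r\<^sup>2 + 2 * (x0 \<bullet> x) - x0 \<bullet> x0"
      by (simp add: inner_diff_left inner_diff_right inner_commute)
    ultimately show ?thesis by (simp add: w_def l_def algebra_simps)
  qed
  have "x0 \<in> ball x0 r" using r by simp
  from subharmonic_onD[OF s(1) r c h sp this] have "s x0 \<le> H x0 + l x0" .
  then have "\<epsilon> * r\<^sup>2 \<le> 0" by (simp add: l_def algebra_simps)
  then show False using \<epsilon> r by (simp add: mult_le_0_iff)
qed

section \<open>Newtonian potentials of bounded sets\<close>

text \<open>A dimension-free form of Jung's theorem, whose sharp factor n / (2 (n + 1)) is below
  1/2. The centre minimises the largest distance to the closure of \<open>U\<close>; if the radius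
  were too large, this centre could be improved.\<close>

lemma subset_cball_jung:
  fixes U :: "'a::euclidean_space set"
  assumes U: "bounded U" "U \<noteq> {}"
  obtains c R where "R \<ge> 0" "U \<subseteq> cball c R" "2 * R\<^sup>2 \<le> (diameter U)\<^sup>2"
proof -
  define K where "K = closure U"
  have K: "compact K" "K \<noteq> {}" "bounded K"
    using U by (auto simp: K_def compact_closure bounded_closure)
  define F where "F = (\<lambda>c. SUP x\<in>K. dist c x)"
  have bdd: "bdd_above (dist c ` K)" for c
    using K by (intro bounded_imp_bdd_above compact_imp_bounded compact_continuous_image continuous_intros)
  have le: "dist c x \<le> F c" if "x \<in> K" for c x
    unfolding F_def by (rule cSUP_upper[OF that bdd])
  have lip: "F c \<le> F c' + dist c c'" for c c'
  proof -
    have "dist c x \<le> F c' + dist c c'" if "x \<in> K" for x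
      using le[OF that, of c'] dist_triangle[of c x c'] by linarith
    then show ?thesis unfolding F_def[THEN fun_cong, of c] by (intro cSUP_least K)
  qed
  have cF: "continuous_on S F" for S
    unfolding continuous_on_iff
  proof (intro ballI allI impI)
    fix x e assume "(e::real) > 0"
    then show "\<exists>d>0. \<forall>x'\<in>S. dist x' x < d \<longrightarrow> dist (F x') (F x) < e"
      using lip by (intro exI[of _ e]) (smt (verit) dist_commute dist_real_def)
  qed
  obtain x0 where x0: "x0 \<in> K" using K by blast
  have "compact (cball x0 (F x0))" "cball x0 (F x0) \<noteq> {}"
    using le[OF x0, of x0] by (auto simp: cball_eq_empty)
  then obtain c where c: "c \<in> cball x0 (F x0)" "\<And>z. z \<in> cball x0 (F x0) \<Longrightarrow> F c \<le> F z"
    using continuous_attains_inf[OF _ _ cF] by metis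
  \<comment> \<open>Outside the compact ball \<open>F\<close> already exceeds \<open>F x0\<close>,
    so the minimum found there is global.\<close>
  have min: "F c \<le> F z" for z
  proof (cases "z \<in> cball x0 (F x0)")
    case False
    then have "F x0 < dist z x0" by (simp add: dist_commute)
    also have "\<dots> \<le> F z" by (rule le[OF x0])
    finally show ?thesis using c(2)[of x0] le[OF x0, of x0] by simp
  qed (rule c)
  define R where "R = F c"
  have R0: "R \<ge> 0" using le[OF x0, of c] zero_le_dist[of c x0] unfolding R_def by linarith
  have "\<exists>x\<in>K. \<forall>y\<in>K. dist c y \<le> dist c x"
    by (intro continuous_attains_sup K continuous_intros)
  then obtain x where x: "x \<in> K" "\<forall>y\<in>K. dist c y \<le> dist c x" by blast
  have xR: "dist c x = R"
    unfolding R_def F_def using x by (intro antisym cSUP_upper cSUP_least bdd K) auto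
  define d where "d = diameter U"
  have diam: "dist y z \<le> d" if "y \<in> K" "z \<in> K" for y z
    using diameter_bounded_bound[OF K(3) that] by (simp add: K_def d_def diameter_closure[OF U(1)])
  have "2 * R\<^sup>2 \<le> d\<^sup>2"
  proof (rule ccontr)
    assume "\<not> 2 * R\<^sup>2 \<le> d\<^sup>2"
    then have gt: "2 * R\<^sup>2 - d\<^sup>2 > 0" by simp
    then have Rpos: "R\<^sup>2 > 0" by (smt (verit) zero_le_power2)
    \<comment> \<open>Half the value at which the quadratic loss
      \<open>\<epsilon>\<^sup>2 * R\<^sup>2\<close> would consume the linear gain
      \<open>\<epsilon> * (2 * R\<^sup>2 - d\<^sup>2)\<close>, capped at 1 to keep the weight
      \<open>1 - \<epsilon>\<close> nonnegative.\<close>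
    define \<epsilon> where "\<epsilon> = min 1 ((2 * R\<^sup>2 - d\<^sup>2) / (2 * R\<^sup>2))"
    have \<epsilon>: "0 < \<epsilon>" "\<epsilon> \<le> 1" "\<epsilon> * R\<^sup>2 < 2 * R\<^sup>2 - d\<^sup>2"
    proof -
      have "\<epsilon> * R\<^sup>2 \<le> (2 * R\<^sup>2 - d\<^sup>2) / (2 * R\<^sup>2) * R\<^sup>2"
        by (intro mult_right_mono) (auto simp: \<epsilon>_def)
      also have "\<dots> < 2 * R\<^sup>2 - d\<^sup>2" using gt Rpos by simp
      finally show "\<epsilon> * R\<^sup>2 < 2 * R\<^sup>2 - d\<^sup>2" .
    qed (use gt Rpos in \<open>auto simp: \<epsilon>_def\<close>)
    define c' where "c' = c + \<epsilon> *\<^sub>R (x - c)"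
    define \<rho> where "\<rho> = R\<^sup>2 - \<epsilon> * (2 * R\<^sup>2 - d\<^sup>2 - \<epsilon> * R\<^sup>2)"
    \<comment> \<open>Moving the centre of the smallest ball towards a farthest point \<open>x\<close> brings every point
      of \<open>K\<close> closer than \<open>R\<close>.\<close>
    have "(dist c' y)\<^sup>2 \<le> \<rho>" if y: "y \<in> K" for y
    proof -
      have 1: "(dist c' y)\<^sup>2 = (y - c) \<bullet> (y - c) - 2 * \<epsilon> * ((y - c) \<bullet> (x - c)) + \<epsilon>\<^sup>2 * ((x - c) \<bullet> (x - c))"
        unfolding dist_norm power2_norm_eq_inner c'_def
        by (simp add: inner_diff_left inner_diff_right inner_add_left inner_add_right inner_commute
            power2_eq_square algebra_simps)
      have 2: "(x - c) \<bullet> (x - c) = R\<^sup>2"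
        using xR by (simp add: dot_square_norm dist_norm norm_minus_commute)
      have 3: "(y - c) \<bullet> (y - c) \<le> R\<^sup>2"
        using le[OF y, of c] R_def
        by (simp add: dot_square_norm dist_norm norm_minus_commute power_mono)
      have "(y - x) \<bullet> (y - x) \<le> d\<^sup>2"
        using diam[OF y x(1)] by (simp add: dot_square_norm dist_norm power_mono)
      moreover have "(y - x) \<bullet> (y - x) = (y - c) \<bullet> (y - c) - 2 * ((y - c) \<bullet> (x - c)) + (x - c) \<bullet> (x - c)"
        by (simp add: inner_diff_left inner_diff_right inner_commute algebra_simps)
      \<comment> \<open>Polarisation: since \<open>y\<close> is within \<open>d\<close> of the
        farthest point \<open>x\<close>, it leans towards \<open>x\<close> as seen from
        \<open>c\<close>. This is the only place where the diameter enters.\<close>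
      ultimately have 4: "2 * ((y - c) \<bullet> (x - c)) \<ge> (y - c) \<bullet> (y - c) + R\<^sup>2 - d\<^sup>2"
        using 2 by linarith
      have "(dist c' y)\<^sup>2 \<le> (y - c) \<bullet> (y - c) - \<epsilon> * ((y - c) \<bullet> (y - c) + R\<^sup>2 - d\<^sup>2) + \<epsilon>\<^sup>2 * R\<^sup>2"
        using mult_left_mono[OF 4, of \<epsilon>] \<epsilon>(1) unfolding 1 2 by (simp add: algebra_simps)
      also have "\<dots> = (1 - \<epsilon>) * ((y - c) \<bullet> (y - c)) - \<epsilon> * (R\<^sup>2 - d\<^sup>2) + \<epsilon>\<^sup>2 * R\<^sup>2"
        by (simp add: algebra_simps)
      also have "\<dots> \<le> (1 - \<epsilon>) * R\<^sup>2 - \<epsilon> * (R\<^sup>2 - d\<^sup>2) + \<epsilon>\<^sup>2 * R\<^sup>2"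
        using mult_left_mono[OF 3, of "1 - \<epsilon>"] \<epsilon>(2) by simp
      also have "\<dots> = \<rho>" by (simp add: \<rho>_def algebra_simps power2_eq_square)
      finally show ?thesis .
    qed
    then have "F c' \<le> sqrt \<rho>"
      unfolding F_def by (intro cSUP_least K real_le_rsqrt) auto
    moreover have "\<rho> < R\<^sup>2" using \<epsilon> by (simp add: \<rho>_def)
    then have "sqrt \<rho> < R" using real_sqrt_less_mono[of \<rho> "R\<^sup>2"] R0 by simp
    ultimately show False using min[of c'] R_def by simp
  qed
  moreover have "U \<subseteq> cball c R"
    using le closure_subset[of U] by (auto simp: K_def R_def)
  ultimately show ?thesis using that R0 d_def by blast
qed

text \<open>Layer-cake computation: the power at \<open>z\<close> is its value at radius
  \<open>R\<close> plus the integral of \<open>(n - 2) * r powr (1 - n)\<close> over r from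
  \<open>norm z\<close> to \<open>R\<close>. After exchanging the integrals only volumes of balls
  occur, and the slice at radius r contributes \<open>(n - 2) * \<alpha> * r\<close>.\<close>

lemma nn_integral_norm_powr_cball:
  assumes n: "DIM('a::euclidean_space) \<ge> 3" and R: "R > 0"
  shows "(\<integral>\<^sup>+z. ennreal (norm z powr (2 - real DIM('a))) * indicator (cball (0::'a) R) z \<partial>lborel)
    = ennreal (real DIM('a) * unit_ball_vol (real DIM('a)) * R\<^sup>2 / 2)"
proof -
  define n where "n = real DIM('a)"
  define \<alpha> where "\<alpha> = unit_ball_vol n"
  have n3: "n \<ge> 3" using assms(1) by (simp add: n_def)
  have \<alpha>: "\<alpha> \<ge> 0" by (simp add: \<alpha>_def n_def)
  define k where "k = (\<lambda>(z::'a) r. ennreal ((n - 2) * r powr (1 - n)) * indicator {norm z..R} r)"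
  have km: "(\<lambda>(z, r). k z r) \<in> borel_measurable (lborel \<Otimes>\<^sub>M lborel)"
    unfolding k_def indicator_def atLeastAtMost_iff split_beta by measurable
  have km': "(\<lambda>z. \<integral>\<^sup>+r. k z r \<partial>lborel) \<in> borel_measurable lborel"
    by (rule lborel.borel_measurable_nn_integral[OF km])
  have fm: "(\<lambda>z::'a. ennreal (R powr (2 - n)) * indicator (cball 0 R) z) \<in> borel_measurable lborel"
    by (intro borel_measurable_times_ennreal borel_measurable_indicator) auto
  have layer: "ennreal (norm z powr (2 - n)) * indicator (cball 0 R) z
      = ennreal (R powr (2 - n)) * indicator (cball 0 R) z + (\<integral>\<^sup>+r. k z r \<partial>lborel)"
    if z: "z \<noteq> 0" for z :: 'a
  proof (cases "norm z \<le> R")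
    case True
    have "(\<integral>\<^sup>+r. k z r \<partial>lborel) = ennreal (- (R powr (2 - n)) - - (norm z powr (2 - n)))"
      unfolding k_def
    proof (rule nn_integral_FTC_Icc)
      show "((\<lambda>r. - (r powr (2 - n))) has_real_derivative (n - 2) * x powr (1 - n)) (at x)"
        if "x \<in> {norm z..R}" for x
      proof -
        have "x > 0" using that z by (metis atLeastAtMost_iff less_le_trans zero_less_norm_iff)
        from DERIV_minus[OF has_real_derivative_powr[OF this, of "2 - n"]]
        show ?thesis by (simp add: algebra_simps)
      qed
    qed (use True n3 in auto)
    moreover have "R powr (2 - n) \<le> norm z powr (2 - n)"
      using True z n3 by (intro powr_mono2') auto
    ultimately show ?thesis using True
      by (simp add: ennreal_plus[symmetric] del: ennreal_plus)
  qed (auto simp: k_def)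
  have slice: "(\<integral>\<^sup>+z. k z r \<partial>lborel) = ennreal ((n - 2) * \<alpha> * r) * indicator {0..R} r" if "r \<noteq> 0" for r
  proof (cases "0 < r \<and> r \<le> R")
    case True
    have "(\<integral>\<^sup>+z. k z r \<partial>lborel) = (\<integral>\<^sup>+z. ennreal ((n - 2) * r powr (1 - n)) * indicator (cball (0::'a) r) z \<partial>lborel)"
      using True by (intro nn_integral_cong) (auto simp: k_def indicator_def)
    also have "\<dots> = ennreal ((n - 2) * r powr (1 - n)) * ennreal (\<alpha> * r ^ DIM('a))"
      using True by (simp add: nn_integral_cmult_indicator emeasure_cball \<alpha>_def n_def)
    also have "\<dots> = ennreal ((n - 2) * r powr (1 - n) * (\<alpha> * r ^ DIM('a)))"
      using True n3 \<alpha> by (simp add: ennreal_mult)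
    also have "(n - 2) * r powr (1 - n) * (\<alpha> * r ^ DIM('a)) = (n - 2) * \<alpha> * (r powr (1 - n) * r powr n)"
      using True by (simp add: n_def powr_realpow)
    also have "r powr (1 - n) * r powr n = r"
      using True by (simp add: powr_add[symmetric])
    finally show ?thesis using True by simp
  next
    case False
    then have "k z r = 0" for z
      using that order_trans[OF norm_ge_zero[of z], of r] by (auto simp: k_def indicator_def)
    moreover have "indicator {0..R} r = (0::ennreal)" using False that by (auto simp: indicator_def)
    ultimately show ?thesis by simp
  qed
  have ae0: "AE z in lborel. z \<noteq> (0::'a)" "AE r in lborel. r \<noteq> (0::real)" by (auto intro: AE_lborel_singleton)
  have "(\<integral>\<^sup>+z. ennreal (norm z powr (2 - n)) * indicator (cball (0::'a) R) z \<partial>lborel)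
    = (\<integral>\<^sup>+z. ennreal (R powr (2 - n)) * indicator (cball 0 R) z + (\<integral>\<^sup>+r. k z r \<partial>lborel) \<partial>lborel)"
    by (rule nn_integral_cong_AE) (use ae0(1) layer in auto)
  also have "\<dots> = (\<integral>\<^sup>+z. ennreal (R powr (2 - n)) * indicator (cball (0::'a) R) z \<partial>lborel)
      + (\<integral>\<^sup>+z. (\<integral>\<^sup>+r. k z r \<partial>lborel) \<partial>lborel)"
    by (rule nn_integral_add[OF fm km'])
  also have "(\<integral>\<^sup>+z. (\<integral>\<^sup>+r. k z r \<partial>lborel) \<partial>lborel) = (\<integral>\<^sup>+r. (\<integral>\<^sup>+z. k z r \<partial>lborel) \<partial>lborel)"
    by (rule lborel_pair.Fubini'[symmetric, OF km])
  also have "\<dots> = (\<integral>\<^sup>+r. ennreal ((n - 2) * \<alpha> * r) * indicator {0..R} r \<partial>lborel)"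
    by (rule nn_integral_cong_AE) (use ae0(2) slice in auto)
  also have "\<dots> = ennreal ((n - 2) * \<alpha> * R\<^sup>2 / 2 - (n - 2) * \<alpha> * 0\<^sup>2 / 2)"
    by (rule nn_integral_FTC_Icc) (use n3 \<alpha> R in \<open>auto intro!: derivative_eq_intros\<close>)
  also have "(\<integral>\<^sup>+z. ennreal (R powr (2 - n)) * indicator (cball (0::'a) R) z \<partial>lborel)
     = ennreal (R powr (2 - n) * (\<alpha> * R powr n))"
    using R \<alpha> by (simp add: nn_integral_cmult_indicator emeasure_cball \<alpha>_def n_def powr_realpow ennreal_mult)
  also have "R powr (2 - n) * (\<alpha> * R powr n) = \<alpha> * (R powr (2 - n) * R powr n)" by simp
  also have "R powr (2 - n) * R powr n = R\<^sup>2"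
    using R by (simp add: powr_add[symmetric] powr_numeral)
  also have "ennreal (\<alpha> * R\<^sup>2) + ennreal ((n - 2) * \<alpha> * R\<^sup>2 / 2 - (n - 2) * \<alpha> * 0\<^sup>2 / 2)
     = ennreal (\<alpha> * R\<^sup>2 + (n - 2) * \<alpha> * R\<^sup>2 / 2)"
    using \<alpha> n3 by (simp add: ennreal_plus)
  also have "\<alpha> * R\<^sup>2 + (n - 2) * \<alpha> * R\<^sup>2 / 2 = n * \<alpha> * R\<^sup>2 / 2" by (simp add: field_simps)
  finally show ?thesis by (simp add: n_def \<alpha>_def)
qed

lemma borel_measurable_fundamental_solution[measurable]:
  "(fundamental_solution :: 'a::euclidean_space \<Rightarrow> real) \<in> borel_measurable borel"
  unfolding fundamental_solution_def by measurable

lemma fundamental_solution_nonneg: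
  "DIM('a::euclidean_space) \<ge> 3 \<Longrightarrow> fundamental_solution (z::'a) \<ge> 0"
  unfolding fundamental_solution_def by (auto intro!: mult_nonneg_nonneg)

lemma fundamental_solution_mono:
  "DIM('a::euclidean_space) \<ge> 3 \<Longrightarrow> 0 < norm z \<Longrightarrow> norm z \<le> norm w \<Longrightarrow>
    fundamental_solution (w::'a) \<le> fundamental_solution (z::'a)"
  unfolding fundamental_solution_def
  by (intro mult_left_mono powr_mono2') auto

text \<open>The potential of a ball at its own centre: after translating the pole to 0, the
  normalising constant cancels the area of the unit sphere.\<close>

lemma nn_integral_fundamental_solution_cball:
  assumes n: "DIM('a::euclidean_space) \<ge> 3" and R: "R > 0"
  shows "(\<integral>\<^sup>+y. ennreal (fundamental_solution (x - y)) * indicator (cball (x::'a) R) y \<partial>lborel)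
    = ennreal (R\<^sup>2 / (2 * (real DIM('a) - 2)))"
proof -
  define C where "C = 1 / (real DIM('a) * unit_ball_vol (real DIM('a)) * (real DIM('a) - 2))"
  have C: "C \<ge> 0" using n by (simp add: C_def)
  have "(\<integral>\<^sup>+y. ennreal (fundamental_solution (x - y)) * indicator (cball x R) y \<partial>lborel)
      = (\<integral>\<^sup>+z. ennreal (fundamental_solution (x - (x + z))) * indicator (cball x R) (x + z) \<partial>lborel)"
    by (subst lborel_distr_plus[symmetric, of x], subst nn_integral_distr)
      (auto intro!: borel_measurable_times_ennreal borel_measurable_indicator)
  also have "\<dots> = (\<integral>\<^sup>+z. ennreal C * (ennreal (norm z powr (2 - real DIM('a))) * indicator (cball (0::'a) R) z) \<partial>lborel)"
    using C by (intro nn_integral_cong)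
      (auto simp: fundamental_solution_def indicator_def C_def dist_norm ennreal_mult[symmetric])
  also have "\<dots> = ennreal C * ennreal (real DIM('a) * unit_ball_vol (real DIM('a)) * R\<^sup>2 / 2)"
    unfolding nn_integral_norm_powr_cball[OF n R, symmetric]
    by (rule nn_integral_cmult) (auto intro!: borel_measurable_times_ennreal borel_measurable_indicator)
  also have "\<dots> = ennreal (C * (real DIM('a) * unit_ball_vol (real DIM('a)) * R\<^sup>2 / 2))"
    using C by (intro ennreal_mult[symmetric]) auto
  also have "C * (real DIM('a) * unit_ball_vol (real DIM('a)) * R\<^sup>2 / 2) = R\<^sup>2 / (2 * (real DIM('a) - 2))"
  proof -
    have "real DIM('a) * unit_ball_vol (real DIM('a)) > 0" by (intro mult_pos_pos) auto
    moreover have "real DIM('a) - 2 > 0" using n by linarith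
    moreover have "1 / (\<beta> * m) * (\<beta> * R\<^sup>2 / 2) = R\<^sup>2 / (2 * m)" if "\<beta> > 0" "m > 0" for \<beta> m :: real
      using that by (simp add: field_simps)
    ultimately show ?thesis unfolding C_def by blast
  qed
  finally show ?thesis .
qed

text \<open>Among sets of a given volume, the ball centred at the pole maximises the integral.\<close>

lemma nn_integral_fundamental_solution_le:
  fixes U :: "'a::euclidean_space set"
  assumes n: "DIM('a) \<ge> 3" and U: "U \<in> sets borel" "bounded U" "U \<noteq> {}"
  shows "(\<integral>\<^sup>+y. ennreal (fundamental_solution (x - y)) * indicator U y \<partial>lborel) \<le> ennreal (l0 U / 2)"
proof -
  obtain c R0 where R0: "R0 \<ge> 0" "U \<subseteq> cball c R0" "2 * R0\<^sup>2 \<le> (diameter U)\<^sup>2"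
    using subset_cball_jung[OF U(2,3)] .
  let ?I = "\<integral>\<^sup>+y. ennreal (fundamental_solution (x - y)) * indicator U y \<partial>lborel"
  have bound: "?I \<le> ennreal (R\<^sup>2 / (2 * (real DIM('a) - 2)))" if R: "R > 0" "R \<ge> R0" for R
  proof -
    obtain e :: 'a where e: "norm e = 1" using vector_choose_size[of 1] by auto
    \<comment> \<open>The value of the kernel on the sphere bounding the comparison ball: the kernel
      is at least \<open>t\<close> inside it, off the pole, and at most \<open>t\<close>
      outside.\<close>
    define t where "t = fundamental_solution (R *\<^sub>R e)"
    have t: "t \<ge> 0" unfolding t_def by (rule fundamental_solution_nonneg[OF n])
    let ?B = "cball x R" and ?\<Phi> = "\<lambda>y. ennreal (fundamental_solution (x - y))"
    have UR: "U \<subseteq> cball c R" using R0(2) R(2) by (auto simp: subset_iff)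
    \<comment> \<open>This says that (kernel - t) * (indicator of \<open>U\<close> - indicator of
      the ball) <= 0, rearranged so that no subtraction of extended reals occurs.\<close>
    have "AE y in lborel. ?\<Phi> y * indicator U y + ennreal t * indicator ?B y
        \<le> ?\<Phi> y * indicator ?B y + ennreal t * indicator U y"
    proof -
      have "?\<Phi> y * indicator U y + ennreal t * indicator ?B y
        \<le> ?\<Phi> y * indicator ?B y + ennreal t * indicator U y" if "y \<noteq> x" for y
      proof (cases "y \<in> ?B")
        case True
        then have "t \<le> fundamental_solution (x - y)"
          unfolding t_def using that R e by (intro fundamental_solution_mono n) (auto simp: dist_norm)
        then show ?thesis using True by (auto simp: indicator_def intro: ennreal_leI)
      next
        case False
        then have "fundamental_solution (x - y) \<le> t"
          unfolding t_def using that R e by (intro fundamental_solution_mono n) (auto simp: dist_norm)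
        then show ?thesis using False by (auto simp: indicator_def intro: ennreal_leI)
      qed
      with AE_lborel_singleton[of x] show ?thesis by auto
    qed
    then have "(\<integral>\<^sup>+y. ?\<Phi> y * indicator U y + ennreal t * indicator ?B y \<partial>lborel)
       \<le> (\<integral>\<^sup>+y. ?\<Phi> y * indicator ?B y + ennreal t * indicator U y \<partial>lborel)"
      by (rule nn_integral_mono_AE)
    then have "?I + ennreal t * emeasure lborel ?B
       \<le> (\<integral>\<^sup>+y. ?\<Phi> y * indicator ?B y \<partial>lborel) + ennreal t * emeasure lborel U"
      using U(1) by (subst (asm) (1 2) nn_integral_add) 
        (auto simp: nn_integral_cmult_indicator intro!: borel_measurable_times_ennreal borel_measurable_indicator)
    also have "emeasure lborel U \<le> emeasure lborel (cball c R)"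
      by (intro emeasure_mono UR) auto
    then have "ennreal t * emeasure lborel U \<le> ennreal t * emeasure lborel ?B"
      using R by (intro mult_left_mono) (auto simp: emeasure_cball)
    finally have "?I + ennreal t * emeasure lborel ?B
       \<le> (\<integral>\<^sup>+y. ?\<Phi> y * indicator ?B y \<partial>lborel) + ennreal t * emeasure lborel ?B"
      by (simp add: add_left_mono)
    \<comment> \<open>Finiteness is what allows this term to be cancelled on both sides.\<close>
    moreover have "ennreal t * emeasure lborel ?B < \<infinity>"
      using R t by (simp add: emeasure_cball ennreal_mult[symmetric])
    ultimately show ?thesis
      using nn_integral_fundamental_solution_cball[OF n R(1), of x]
      by (simp add: add.commute[of _ "ennreal t * _"] ennreal_add_left_cancel_le)
        (auto simp: less_top)
  qed
  have "?I \<le> ennreal (R0\<^sup>2 / (2 * (real DIM('a) - 2)))"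
  proof (cases "R0 > 0")
    \<comment> \<open>The rearrangement bound was for positive radii; with radius 0 the set is
      contained in one point and the integral vanishes.\<close>
    case False
    then have "U \<subseteq> {c}" using R0 by auto
    then have "AE y in lborel. y \<notin> U" using AE_lborel_singleton[of c] by (auto simp: subset_iff)
    then have "?I = (\<integral>\<^sup>+y. 0 \<partial>(lborel::'a measure))" by (intro nn_integral_cong_AE) auto
    then show ?thesis by simp
  qed (rule bound, auto)
  \<comment> \<open>The decisive factor 1/2 arises here: \<open>l0\<close> contains the full squared
    diameter, while the squared radius is at most half of it.\<close>
  also have "\<dots> \<le> ennreal (l0 U / 2)"
  proof (rule ennreal_leI)
    have "real DIM('a) - 2 > 0" using n by linarith
    moreover have "R0\<^sup>2 / (2 * m) \<le> (diameter U)\<^sup>2 / (2 * m) / 2" if "m > 0" for m :: real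
      using that R0(3) by (simp add: divide_right_mono field_simps)
    ultimately show "R0\<^sup>2 / (2 * (real DIM('a) - 2)) \<le> l0 U / 2" unfolding l0_def by blast
  qed
  finally show ?thesis .
qed

section \<open>The Green function\<close>

definition perron_family :: "'a::euclidean_space set \<Rightarrow> ('a \<Rightarrow> real) \<Rightarrow> ('a \<Rightarrow> real) set"
  where "perron_family U \<phi> =
    {s. continuous_on (closure U) s \<and> subharmonic_on s U \<and> (\<forall>z\<in>frontier U. s z \<le> \<phi> z)}"

lemma perron_solution_eq: "perron_solution U \<phi> x = (SUP s\<in>perron_family U \<phi>. s x)"
  by (simp add: perron_solution_def perron_family_def)

lemma const_in_perron_family:
  assumes "\<And>z. z \<in> frontier U \<Longrightarrow> k \<le> \<phi> z"
  shows "(\<lambda>_. k) \<in> perron_family U \<phi>"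
  using assms by (auto simp: perron_family_def subharmonic_on_const)

lemma perron_family_le:
  fixes U :: "'a::euclidean_space set"
  assumes "open U" "bounded U" "s \<in> perron_family U \<phi>" "x \<in> U"
    and "\<And>z. z \<in> frontier U \<Longrightarrow> \<phi> z \<le> B"
  shows "s x \<le> B"
proof (rule subharmonic_le_harmonic[OF assms(1,2)])
  show "continuous_on (closure U) (\<lambda>_. B)" by (rule continuous_on_const)
  show "harmonic_on (\<lambda>_. B) U" by (rule harmonic_on_const)
  show "s z \<le> B" if "z \<in> frontier U" for z
    using assms(3) assms(5)[OF that] that by (force simp: perron_family_def)
qed (use assms in \<open>auto simp: perron_family_def\<close>)

section \<open>The Perron correction for boundary values of the fundamental solution\<close>

lemma continuous_on_fundamental_solution:
  "continuous_on (- {0}) (fundamental_solution :: 'a::euclidean_space \<Rightarrow> real)"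
  unfolding fundamental_solution_def by (intro continuous_intros) auto

lemma frontier_disjoint_open: "open U \<Longrightarrow> y \<in> U \<Longrightarrow> z \<in> frontier U \<Longrightarrow> z \<noteq> y"
  by (auto simp: frontier_def interior_open)

text \<open>A real supremum is only meaningful for a bounded family. The pole is interior, so the
  boundary values are continuous on the compact frontier, and their maximum bounds every
  competitor.\<close>

lemma bdd_above_perron_family_fundamental_solution:
  fixes U :: "'a::euclidean_space set"
  assumes U: "open U" "bounded U" and xy: "x \<in> U" "y \<in> U"
  shows "bdd_above ((\<lambda>s. s x) ` perron_family U (\<lambda>z. fundamental_solution (z - y)))"
proof -
  have "compact (frontier U)" using U(2) by (rule compact_frontier_bounded)
  moreover have "continuous_on (frontier U) (\<lambda>z. fundamental_solution (z - y))"
    by (rule continuous_on_compose2[OF continuous_on_fundamental_solution])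
      (use frontier_disjoint_open[OF U(1) xy(2)] in \<open>auto intro!: continuous_intros\<close>)
  ultimately have "bdd_above ((\<lambda>z. fundamental_solution (z - y)) ` frontier U)"
    by (intro bounded_imp_bdd_above compact_imp_bounded compact_continuous_image)
  then obtain B where "\<And>z. z \<in> frontier U \<Longrightarrow> fundamental_solution (z - y) \<le> B"
    unfolding bdd_above_def by auto
  with perron_family_le[OF U _ xy(1)] show ?thesis
    unfolding bdd_above_def by (intro exI[of _ B]) auto
qed

lemma fundamental_solution_ge_near_0:
  assumes n: "DIM('a::euclidean_space) \<ge> 3"
  obtains \<rho>0 where "\<rho>0 > 0" "\<And>z::'a. 0 < norm z \<Longrightarrow> norm z \<le> \<rho>0 \<Longrightarrow> B \<le> fundamental_solution z"
proof -
  define C where "C = 1 / (real DIM('a) * unit_ball_vol (real DIM('a)) * (real DIM('a) - 2))"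
  have C: "C > 0" using n by (simp add: C_def)
  \<comment> \<open>For norms at most 1 and dimension at least 3, the power \<open>2 - n\<close>
    dominates the power -1, so it is enough that C divided by the norm exceeds
    \<open>\<bar>B\<bar> + 1\<close>.\<close>
  define \<rho>0 where "\<rho>0 = min 1 (C / (\<bar>B\<bar> + 1))"
  have \<rho>0: "\<rho>0 > 0" "\<rho>0 \<le> 1" "\<rho>0 * (\<bar>B\<bar> + 1) \<le> C"
  proof -
    have "\<rho>0 * (\<bar>B\<bar> + 1) \<le> C / (\<bar>B\<bar> + 1) * (\<bar>B\<bar> + 1)"
      by (rule mult_right_mono) (auto simp: \<rho>0_def)
    then show "\<rho>0 * (\<bar>B\<bar> + 1) \<le> C" by simp
  qed (use C in \<open>auto simp: \<rho>0_def divide_pos_pos add_nonneg_pos\<close>)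
  have "B \<le> fundamental_solution z" if z: "0 < norm z" "norm z \<le> \<rho>0" for z :: 'a
  proof -
    have "norm z * (\<bar>B\<bar> + 1) \<le> C"
      using mult_right_mono[OF z(2), of "\<bar>B\<bar> + 1"] \<rho>0(3) by simp
    then have "\<bar>B\<bar> + 1 \<le> C * inverse (norm z)" using z by (simp add: field_simps)
    also have "inverse (norm z) = norm z powr (- 1)" using z by (simp add: powr_minus)
    also have "norm z powr (- 1) \<le> norm z powr (2 - real DIM('a))"
      using z \<rho>0(2) n by (intro powr_mono') auto
    finally have "\<bar>B\<bar> + 1 \<le> C * norm z powr (2 - real DIM('a))" using C by simp
    then show ?thesis by (simp add: fundamental_solution_def C_def)
  qed
  with that \<rho>0(1) show ?thesis by blast
qed

text \<open>The kernel is not harmonic across its pole, so the comparison takes place in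
  \<open>U\<close> minus a small closed ball about \<open>y\<close>. On the new boundary sphere the
  kernel already exceeds the maximum of \<open>s\<close> over the closure of \<open>U\<close>, and
  the ball is small enough to leave out \<open>x\<close>.\<close>

lemma perron_family_le_fundamental_solution:
  fixes U :: "'a::euclidean_space set"
  assumes n: "DIM('a) \<ge> 3" and U: "open U" "bounded U" and xy: "x \<in> U" "y \<in> U" "x \<noteq> y"
    and s: "s \<in> perron_family U (\<lambda>z. fundamental_solution (z - y))"
  shows "s x \<le> fundamental_solution (x - y)"
proof -
  have s': "continuous_on (closure U) s" "subharmonic_on s U"
    "\<And>z. z \<in> frontier U \<Longrightarrow> s z \<le> fundamental_solution (z - y)"
    using s by (auto simp: perron_family_def)
  have "bounded (s ` closure U)"
    using U(2) s'(1) by (intro compact_imp_bounded compact_continuous_image) (auto simp: compact_closure)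
  then obtain B where B: "\<And>z. z \<in> closure U \<Longrightarrow> s z \<le> B"
    unfolding bounded_real by (meson abs_le_D1 imageI)
  obtain \<rho>0 where \<rho>0: "\<rho>0 > 0"
    "\<And>z::'a. 0 < norm z \<Longrightarrow> norm z \<le> \<rho>0 \<Longrightarrow> B \<le> fundamental_solution z"
    using fundamental_solution_ge_near_0[OF n] by blast
  define \<rho> where "\<rho> = min \<rho>0 (dist x y / 2)"
  have \<rho>: "0 < \<rho>" "\<rho> \<le> \<rho>0" "\<rho> < dist x y"
    using \<rho>0(1) xy(3) by (auto simp: \<rho>_def min_def not_le)
  define U' where "U' = U - cball y \<rho>"
  have "closure U' \<subseteq> - ball y \<rho>"
    by (rule closure_minimal) (auto simp: U'_def closed_Compl)
  then have ny: "y \<notin> closure U'" using \<rho> by auto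
  have cl: "closure U' \<subseteq> closure U" by (rule closure_mono) (auto simp: U'_def)
  have "frontier U' \<subseteq> frontier U \<union> frontier (- cball y \<rho>)"
    unfolding U'_def Diff_eq using frontier_Int_subset by blast
  then have fr: "frontier U' \<subseteq> frontier U \<union> sphere y \<rho>" by (simp add: frontier_complement)
  show ?thesis
  proof (rule subharmonic_le_harmonic[of U' s "\<lambda>z. fundamental_solution (z - y)" x])
    show "open U'" "bounded U'" using U by (auto simp: U'_def bounded_diff)
    show "subharmonic_on s U'" using s'(2) by (rule subharmonic_on_subset) (auto simp: U'_def)
    show "continuous_on (closure U') s" using s'(1) cl by (rule continuous_on_subset)
    show "harmonic_on (\<lambda>z. fundamental_solution (z - y)) U'"
      by (rule harmonic_on_subset[OF harmonic_on_fundamental_solution]) (use \<rho> in \<open>auto simp: U'_def\<close>)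
    show "continuous_on (closure U') (\<lambda>z. fundamental_solution (z - y))"
      by (rule continuous_on_compose2[OF continuous_on_fundamental_solution])
        (use ny in \<open>auto intro!: continuous_intros\<close>)
    show "s z \<le> fundamental_solution (z - y)" if "z \<in> frontier U'" for z
    proof (cases "z \<in> frontier U")
      case False
      with fr that have "norm (z - y) = \<rho>" by (auto simp: dist_norm norm_minus_commute)
      moreover have "z \<in> closure U" using that cl by (auto simp: frontier_def)
      ultimately show ?thesis using B[of z] \<rho>0(2)[of "z - y"] \<rho> by simp
    qed (rule s'(3))
    show "x \<in> U'" using xy \<rho> by (simp add: U'_def dist_commute)
  qed
qed

text \<open>The Perron correction lies between 0, which is itself a competitor, and the kernel. The
  diagonal is excluded because \<open>0 powr a = 0\<close> makes the formal value of the kernel at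
  its pole 0.\<close>

lemma green_bounds:
  fixes U :: "'a::euclidean_space set"
  assumes n: "DIM('a) \<ge> 3" and U: "open U" "bounded U" and xy: "x \<in> U" "y \<in> U" "x \<noteq> y"
  shows "0 \<le> green U x y" "green U x y \<le> fundamental_solution (x - y)"
proof -
  have 0: "(\<lambda>_. 0) \<in> perron_family U (\<lambda>z. fundamental_solution (z - y))"
    by (rule const_in_perron_family) (rule fundamental_solution_nonneg[OF n])
  have "perron_solution U (\<lambda>z. fundamental_solution (z - y)) x \<le> fundamental_solution (x - y)"
    unfolding perron_solution_eq
    by (rule cSUP_least) (use 0 perron_family_le_fundamental_solution[OF n U xy] in auto)
  then show "0 \<le> green U x y" by (simp add: green_def)
  have "0 \<le> perron_solution U (\<lambda>z. fundamental_solution (z - y)) x"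
    unfolding perron_solution_eq
    using cSUP_upper[OF 0 bdd_above_perron_family_fundamental_solution[OF U xy(1,2)]] by simp
  then show "green U x y \<le> fundamental_solution (x - y)" by (simp add: green_def)
qed

text \<open>Poles in a closed ball inside \<open>U\<close> stay away from the frontier, so the
  kernel is uniformly continuous on the compact product of that ball with the frontier.\<close>

lemma fundamental_solution_boundary_values_continuous:
  fixes U :: "'a::euclidean_space set"
  assumes U: "open U" "bounded U" and y: "y \<in> U" and \<delta>: "\<delta> > 0"
  obtains \<eta> where "\<eta> > 0" "\<And>y' z. dist y' y < \<eta> \<Longrightarrow> z \<in> frontier U \<Longrightarrow>
    fundamental_solution (z - y) \<le> fundamental_solution (z - y') + \<delta>"
proof -
  obtain \<eta>0 where \<eta>0: "\<eta>0 > 0" "cball y \<eta>0 \<subseteq> U" using U(1) y open_contains_cball by blast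
  let ?K = "cball y \<eta>0 \<times> frontier U" and ?F = "\<lambda>(w, z). fundamental_solution (z - w) :: real"
  have "compact ?K" using U(2) by (intro compact_Times compact_cball compact_frontier_bounded)
  moreover have "continuous_on ?K ?F"
    unfolding split_beta
    by (rule continuous_on_compose2[OF continuous_on_fundamental_solution])
      (use \<eta>0 frontier_disjoint_open[OF U(1)] in \<open>auto intro!: continuous_intros\<close>)
  ultimately have "uniformly_continuous_on ?K ?F" by (rule compact_uniformly_continuous[rotated])
  then obtain \<eta>1 where \<eta>1: "\<eta>1 > 0"
    "\<And>p q. p \<in> ?K \<Longrightarrow> q \<in> ?K \<Longrightarrow> dist q p < \<eta>1 \<Longrightarrow> dist (?F q) (?F p) < \<delta>"
    using \<delta> unfolding uniformly_continuous_on_def by metis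
  show ?thesis
  proof (rule that[of "min \<eta>0 \<eta>1"])
    fix y' z assume a: "dist y' y < min \<eta>0 \<eta>1" "z \<in> frontier U"
    then have "dist (?F (y', z)) (?F (y, z)) < \<delta>"
      using \<eta>0 by (intro \<eta>1(2)) (auto simp: dist_commute dist_Pair_Pair)
    then show "fundamental_solution (z - y) \<le> fundamental_solution (z - y') + \<delta>"
      by (simp add: dist_real_def)
  qed (use \<eta>0 \<eta>1 in auto)
qed

text \<open>The Perron correction is a supremum of functions continuous in \<open>x\<close>, and moving the pole
  \<open>y\<close> changes the boundary values uniformly little. So it is jointly lower semicontinuous, which
  yields measurability of the Green function without any interior regularity theory.\<close>

lemma open_perron_solution_greater:
  fixes U :: "'a::euclidean_space set"
  assumes n: "DIM('a) \<ge> 3" and U: "open U" "bounded U"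
  shows "open {(x, y) \<in> U \<times> U. a < perron_solution U (\<lambda>z. fundamental_solution (z - y)) x}"
    (is "open ?S")
  unfolding open_dist
proof (intro ballI)
  fix w assume "w \<in> ?S"
  then obtain x y where w: "w = (x, y)" and xy: "x \<in> U" "y \<in> U"
    and gt: "a < perron_solution U (\<lambda>z. fundamental_solution (z - y)) x" by auto
  have ne: "perron_family U (\<lambda>z. fundamental_solution (z - y)) \<noteq> {}"
    using const_in_perron_family[of U 0 "\<lambda>z. fundamental_solution (z - y)", OF fundamental_solution_nonneg[OF n]]
    by (rule ex_in_conv[THEN iffD1, OF exI])
  obtain s where s: "s \<in> perron_family U (\<lambda>z. fundamental_solution (z - y))" "a < s x"
    using gt unfolding perron_solution_eq
      less_cSUP_iff[OF ne bdd_above_perron_family_fundamental_solution[OF U xy]] by (elim bexE)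
  \<comment> \<open>Half the surplus of \<open>s x\<close> over \<open>a\<close>: one \<delta> is
    spent on moving \<open>x\<close>, the other on moving the pole.\<close>
  define \<delta> where "\<delta> = (s x - a) / 2"
  have \<delta>: "\<delta> > 0" using s(2) by (simp add: \<delta>_def)
  obtain \<eta> where \<eta>: "\<eta> > 0" "\<And>y' z. dist y' y < \<eta> \<Longrightarrow> z \<in> frontier U \<Longrightarrow>
    fundamental_solution (z - y) \<le> fundamental_solution (z - y') + \<delta>"
    using fundamental_solution_boundary_values_continuous[OF U xy(2) \<delta>] by blast
  have "continuous_on U s"
    using s(1) continuous_on_subset[OF _ closure_subset] by (auto simp: perron_family_def)
  then obtain \<xi> where \<xi>: "\<xi> > 0" "\<And>x'. x' \<in> U \<Longrightarrow> dist x' x < \<xi> \<Longrightarrow> dist (s x') (s x) < \<delta>"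
    using xy(1) \<delta> unfolding continuous_on_iff by metis
  obtain \<kappa> where \<kappa>: "\<kappa> > 0" "ball x \<kappa> \<subseteq> U" "ball y \<kappa> \<subseteq> U"
  proof -
    obtain k1 k2 where "k1 > 0" "ball x k1 \<subseteq> U" "k2 > 0" "ball y k2 \<subseteq> U"
      using U(1) xy open_contains_ball by metis
    then show ?thesis by (intro that[of "min k1 k2"]) auto
  qed
  show "\<exists>e>0. \<forall>w'. dist w' w < e \<longrightarrow> w' \<in> ?S"
  proof (intro exI[of _ "min \<kappa> (min \<xi> \<eta>)"] conjI allI impI)
    fix w' assume dw: "dist w' w < min \<kappa> (min \<xi> \<eta>)"
    obtain x' y' where w': "w' = (x', y')" by (cases w')
    have d: "dist x' x < min \<kappa> (min \<xi> \<eta>)" "dist y' y < min \<kappa> (min \<xi> \<eta>)"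
      using dw dist_fst_le[of w' w] dist_snd_le[of w' w] unfolding w w' by auto
    have xy': "x' \<in> U" "y' \<in> U" using d \<kappa> by (auto simp: dist_commute subset_iff)
    \<comment> \<open>Lowering \<open>s\<close> by \<delta> absorbs the change of the boundary
      values and yields a competitor for the new pole.\<close>
    have "(\<lambda>x. s x - \<delta>) \<in> perron_family U (\<lambda>z. fundamental_solution (z - y'))"
    proof -
      have "s z - \<delta> \<le> fundamental_solution (z - y')" if z: "z \<in> frontier U" for z
      proof -
        have "s z \<le> fundamental_solution (z - y)" using s(1) z by (simp add: perron_family_def)
        then show ?thesis using \<eta>(2)[of y' z] d z by simp
      qed
      then show ?thesis using s(1)
        by (auto simp: perron_family_def subharmonic_on_diff_const intro!: continuous_intros)
    qed
    then have "s x' - \<delta> \<le> perron_solution U (\<lambda>z. fundamental_solution (z - y')) x'"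
      unfolding perron_solution_eq
      using cSUP_upper[OF _ bdd_above_perron_family_fundamental_solution[OF U xy']] by fastforce
    moreover have "s x' > s x - \<delta>" using \<xi>(2)[OF xy'(1)] d by (simp add: dist_real_def)
    ultimately have "a < perron_solution U (\<lambda>z. fundamental_solution (z - y')) x'"
      by (simp add: \<delta>_def field_simps)
    then show "w' \<in> ?S" using xy' w' by simp
  qed (use \<kappa> \<xi> \<eta> in auto)
qed

text \<open>Extension by zero, so that joint Borel measurability and integration over the whole
  space become available.\<close>

definition green_kernel :: "'a::euclidean_space set \<Rightarrow> 'a \<Rightarrow> 'a \<Rightarrow> real"
  where "green_kernel U x y = (if x \<in> U \<and> y \<in> U then green U x y else 0)"

lemma borel_measurable_green_kernel:
  fixes U :: "'a::euclidean_space set"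
  assumes n: "DIM('a) \<ge> 3" and U: "open U" "bounded U"
  shows "(\<lambda>(x, y). green_kernel U x y) \<in> borel_measurable (borel \<Otimes>\<^sub>M borel)"
proof -
  define P where "P = (\<lambda>(x, y). if x \<in> U \<and> y \<in> U then
    perron_solution U (\<lambda>z. fundamental_solution (z - y)) x else 0)"
  have UU: "open (U \<times> U)" using U(1) by (intro open_Times)
  have "P \<in> borel_measurable borel"
    unfolding borel_measurable_iff_greater
  proof
    fix a :: real
    let ?S = "{(x, y) \<in> U \<times> U. a < perron_solution U (\<lambda>z. fundamental_solution (z - y)) x}"
    \<comment> \<open>Outside \<open>U \<times> U\<close> the value is 0, so the complement belongs
      to the superlevel set exactly for negative levels.\<close>
    have "{w \<in> space borel. a < P w} = (if a < 0 then ?S \<union> - (U \<times> U) else ?S)"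
      by (auto simp: P_def split: if_splits)
    then show "{w \<in> space borel. a < P w} \<in> sets borel"
      using open_perron_solution_greater[OF n U, of a] UU by (auto intro!: sets.Un)
  qed
  moreover have "(\<lambda>w. indicator (U \<times> U) w * fundamental_solution (fst w - snd w)) \<in> borel_measurable borel"
    using UU by (intro borel_measurable_times borel_measurable_indicator
        measurable_compose[OF _ borel_measurable_fundamental_solution])
      (auto intro!: borel_measurable_continuous_onI continuous_intros)
  ultimately have "(\<lambda>w. indicator (U \<times> U) w * fundamental_solution (fst w - snd w) - P w) \<in> borel_measurable borel"
    by (rule borel_measurable_diff[rotated])
  also have "(\<lambda>w. indicator (U \<times> U) w * fundamental_solution (fst w - snd w) - P w)
      = (\<lambda>(x, y). green_kernel U x y)"
    by (auto simp: green_kernel_def P_def green_def)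
  finally show ?thesis by (simp add: borel_prod)
qed

lemma borel_measurable_green:
  fixes U :: "'a::euclidean_space set"
  assumes n: "DIM('a) \<ge> 3" and U: "open U" "bounded U" and x: "x \<in> U"
  shows "green U x \<in> borel_measurable (lebesgue_on U)"
proof -
  have "green_kernel U x \<in> borel_measurable borel"
    using measurable_compose[OF measurable_Pair1'[of x borel borel] borel_measurable_green_kernel[OF n U]]
    by simp
  then have "green_kernel U x \<in> borel_measurable (lebesgue_on U)"
    by (intro measurable_restrict_space1) (simp add: measurable_completion)
  then show ?thesis
    by (rule measurable_cong[THEN iffD1, rotated]) (use x in \<open>simp add: green_kernel_def\<close>)
qed

lemma nn_integral_green_le:
  fixes U :: "'a::euclidean_space set"
  assumes n: "DIM('a) \<ge> 3" and U: "open U" "bounded U" and x: "x \<in> U"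
  shows "(\<integral>\<^sup>+y. ennreal \<bar>green U x y\<bar> \<partial>lebesgue_on U) \<le> ennreal (l0 U / 2)"
proof -
  have "(\<integral>\<^sup>+y. ennreal \<bar>green U x y\<bar> \<partial>lebesgue_on U)
      = (\<integral>\<^sup>+y. ennreal \<bar>green U x y\<bar> * indicator U y \<partial>lebesgue)"
    using U(1) by (subst nn_integral_restrict_space) auto
  also have "\<dots> \<le> (\<integral>\<^sup>+y. ennreal (fundamental_solution (x - y)) * indicator U y \<partial>lebesgue)"
  proof (rule nn_integral_mono_AE)
    have "AE y in lebesgue. y \<noteq> x" using AE_completion[OF AE_lborel_singleton[of x]] .
    then show "AE y in lebesgue. ennreal \<bar>green U x y\<bar> * indicator U y
        \<le> ennreal (fundamental_solution (x - y)) * indicator U y"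
    proof eventually_elim
      case (elim y)
      then show ?case using green_bounds[OF n U x, of y]
        by (auto simp: indicator_def intro!: ennreal_leI)
    qed
  qed
  also have "\<dots> = (\<integral>\<^sup>+y. ennreal (fundamental_solution (x - y)) * indicator U y \<partial>lborel)"
    by (rule nn_integral_completion)
  also have "\<dots> \<le> ennreal (l0 U / 2)"
    by (rule nn_integral_fundamental_solution_le[OF n]) (use U x in auto)
  finally show ?thesis .
qed

lemma l0_nonneg: "DIM('a) \<ge> 3 \<Longrightarrow> l0 (U :: 'a::euclidean_space set) \<ge> 0"
  by (auto simp: l0_def)

text \<open>Domination by \<open>B\<close> times the absolute value of the Green function. The
  estimate holds at every point of \<open>U\<close>, not merely almost everywhere, which permits a
  pointwise fixed-point argument later.\<close>

lemma
  fixes U :: "'a::euclidean_space set"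
  assumes n: "DIM('a) \<ge> 3" and U: "open U" "bounded U" and x: "x \<in> U"
    and \<psi>: "\<psi> \<in> borel_measurable (lebesgue_on U)" and B: "AE y in lebesgue_on U. \<bar>\<psi> y\<bar> \<le> B" and B0: "B \<ge> 0"
  shows integrable_green_mult: "integrable (lebesgue_on U) (\<lambda>y. green U x y * \<psi> y)"
    and abs_green_operator_le: "\<bar>green_operator U \<psi> x\<bar> \<le> l0 U / 2 * B"
proof -
  note gm = borel_measurable_green[OF n U x]
  have I: "integrable (lebesgue_on U) (green U x)"
    using nn_integral_green_le[OF n U x] gm
    by (auto simp: integrable_iff_bounded le_less_trans[OF _ ennreal_less_top])
  have Ib: "integrable (lebesgue_on U) (\<lambda>y. B * \<bar>green U x y\<bar>)" using I by auto
  show J: "integrable (lebesgue_on U) (\<lambda>y. green U x y * \<psi> y)"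
  proof (rule Bochner_Integration.integrable_bound[OF Ib])
    show "AE y in lebesgue_on U. norm (green U x y * \<psi> y) \<le> norm (B * \<bar>green U x y\<bar>)"
      using B by eventually_elim (auto simp: abs_mult mult.commute[of B] intro!: mult_left_mono)
  qed (intro borel_measurable_times gm \<psi>)
  have "\<bar>green_operator U \<psi> x\<bar> \<le> (LINT y|lebesgue_on U. \<bar>green U x y * \<psi> y\<bar>)"
    unfolding green_operator_def by (rule integral_abs_bound)
  also have "\<dots> \<le> (LINT y|lebesgue_on U. B * \<bar>green U x y\<bar>)"
  proof (rule integral_mono_AE)
    show "AE y in lebesgue_on U. \<bar>green U x y * \<psi> y\<bar> \<le> B * \<bar>green U x y\<bar>"
      using B by eventually_elim (auto simp: abs_mult mult.commute[of B] intro!: mult_left_mono)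
  qed (use J Ib in auto)
  also have "\<dots> = B * (LINT y|lebesgue_on U. \<bar>green U x y\<bar>)" by simp
  also have "(LINT y|lebesgue_on U. \<bar>green U x y\<bar>) \<le> l0 U / 2"
  proof -
    have "ennreal (LINT y|lebesgue_on U. \<bar>green U x y\<bar>) = (\<integral>\<^sup>+y. ennreal \<bar>green U x y\<bar> \<partial>lebesgue_on U)"
      by (rule nn_integral_eq_integral[symmetric]) (use I in auto)
    also have "\<dots> \<le> ennreal (l0 U / 2)" by (rule nn_integral_green_le[OF n U x])
    finally show ?thesis using l0_nonneg[OF n, of U] by (simp add: ennreal_le_iff)
  qed
  then have "B * (LINT y|lebesgue_on U. \<bar>green U x y\<bar>) \<le> l0 U / 2 * B"
    unfolding mult.commute[of B] using B0 by (rule mult_right_mono)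
  finally show "\<bar>green_operator U \<psi> x\<bar> \<le> l0 U / 2 * B" .
qed

text \<open>The density is only Lebesgue measurable, whereas the kernel is jointly Borel. Replacing
  the density by an almost everywhere equal Borel function leaves the integral at each
  \<open>x\<close> unchanged and makes the parametrised integral measurable in
  \<open>x\<close>.\<close>

lemma borel_measurable_green_operator:
  fixes U :: "'a::euclidean_space set"
  assumes n: "DIM('a) \<ge> 3" and U: "open U" "bounded U" and \<psi>: "\<psi> \<in> borel_measurable (lebesgue_on U)"
  shows "green_operator U \<psi> \<in> borel_measurable (lebesgue_on U)"
proof -
  have Um: "U \<in> sets lebesgue" using U(1) by auto
  define \<psi>0 where "\<psi>0 = (\<lambda>y. if y \<in> U then \<psi> y else 0)"
  have \<psi>0: "\<psi>0 \<in> borel_measurable lebesgue"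
    unfolding \<psi>0_def using \<psi> Um by (simp add: borel_measurable_if)
  then obtain \<psi>' where \<psi>': "\<psi>' \<in> borel_measurable lborel" "AE y in lborel. \<psi>0 y = \<psi>' y"
    using completion_ex_borel_measurable_real by blast
  note km = borel_measurable_green_kernel[OF n U]
  have "(\<lambda>(x, y). green_kernel U x y * \<psi>' y) \<in> borel_measurable (borel \<Otimes>\<^sub>M lborel)"
  proof -
    have "(\<lambda>w. (case w of (x, y) \<Rightarrow> green_kernel U x y) * \<psi>' (snd w)) \<in> borel_measurable (borel \<Otimes>\<^sub>M lborel)"
    proof (rule borel_measurable_times)
      show "(\<lambda>(x, y). green_kernel U x y) \<in> borel_measurable (borel \<Otimes>\<^sub>M lborel)"
        using km by (simp cong: measurable_cong_sets sets_pair_measure_cong)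
      show "(\<lambda>w. \<psi>' (snd w)) \<in> borel_measurable (borel \<Otimes>\<^sub>M lborel)"
        by (rule measurable_compose[OF measurable_snd \<psi>'(1)])
    qed
    then show ?thesis by (simp add: split_beta')
  qed
  then have "(\<lambda>x. LINT y|lborel. green_kernel U x y * \<psi>' y) \<in> borel_measurable borel"
    by (rule lborel.borel_measurable_lebesgue_integral)
  then have m: "(\<lambda>x. LINT y|lborel. green_kernel U x y * \<psi>' y) \<in> borel_measurable (lebesgue_on U)"
    by (intro measurable_restrict_space1) (simp add: measurable_completion)
  have "green_operator U \<psi> x = (LINT y|lborel. green_kernel U x y * \<psi>' y)" if x: "x \<in> U" for x
  proof -
    have kx: "green_kernel U x \<in> borel_measurable lborel"
      using measurable_compose[OF measurable_Pair1'[of x borel borel] km] by simp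
    have "green_operator U \<psi> x = (LINT y|lebesgue. indicator U y *\<^sub>R (green U x y * \<psi> y))"
      unfolding green_operator_def using Um by (subst integral_restrict_space) auto
    also have "\<dots> = (LINT y|lebesgue. green_kernel U x y * \<psi>0 y)"
      by (rule Bochner_Integration.integral_cong) (use x in \<open>auto simp: green_kernel_def \<psi>0_def\<close>)
    also have "\<dots> = (LINT y|lebesgue. green_kernel U x y * \<psi>' y)"
    proof (rule integral_cong_AE)
      show "AE y in lebesgue. green_kernel U x y * \<psi>0 y = green_kernel U x y * \<psi>' y"
        using AE_completion[OF \<psi>'(2)] by eventually_elim simp
    qed (intro borel_measurable_times measurable_completion[OF kx] measurable_completion[OF \<psi>'(1)] \<psi>0)+
    also have "\<dots> = (LINT y|lborel. green_kernel U x y * \<psi>' y)"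
      by (rule integral_completion) (intro borel_measurable_times kx \<psi>')
    finally show ?thesis .
  qed
  with m show ?thesis by (subst measurable_cong) auto
qed

section \<open>Total variation and random potentials\<close>

lemma sets_restrict_borelI: "A \<in> sets borel \<Longrightarrow> A \<subseteq> U \<Longrightarrow> A \<in> sets (restrict_space borel U)"
  by (auto simp: sets_restrict_space)

lemma countably_additive_on_Un:
  assumes \<nu>: "countably_additive_on U \<nu>"
    and A: "A \<in> sets borel" "A \<subseteq> U" and B: "B \<in> sets borel" "B \<subseteq> U" and AB: "A \<inter> B = {}"
  shows "\<nu> (A \<union> B) = \<nu> A + \<nu> B"
proof -
  define F where "F = (\<lambda>i::nat. if i = 0 then A else if i = 1 then B else {})"
  have "range F \<subseteq> sets (restrict_space borel U)"
    using A B by (auto simp: F_def intro!: sets_restrict_borelI)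
  moreover have "disjoint_family F" using AB by (auto simp: disjoint_family_on_def F_def)
  ultimately have "(\<lambda>i. \<nu> (F i)) sums \<nu> (\<Union>i. F i)"
    using \<nu> unfolding countably_additive_on_def by blast
  moreover have "(\<Union>i. F i) = A \<union> B" by (auto simp: F_def split: if_splits)
  moreover have "(\<lambda>i. \<nu> (F i)) sums (\<Sum>i\<in>{0, 1}. \<nu> (F i))"
    using \<nu> by (intro sums_finite) (auto simp: F_def countably_additive_on_def)
  ultimately show ?thesis using sums_unique2 by (fastforce simp: F_def)
qed

lemma variation_cmult: "variation (\<lambda>A. k * \<nu> A) E = ennreal \<bar>k\<bar> * variation \<nu> E"
  unfolding variation_def SUP_mult_left_ennreal
  by (intro SUP_cong refl) (simp only: abs_mult ennreal_mult abs_ge_zero sum_distrib_left)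

lemma variation_add_le: "variation (\<lambda>A. \<nu> A + \<nu>' A) E \<le> variation \<nu> E + variation \<nu>' E"
  unfolding variation_def
proof (rule SUP_least)
  fix P assume P: "P \<in> {P. finite P \<and> P \<subseteq> sets borel \<and> partition_on E P}"
  have "(\<Sum>A\<in>P. ennreal \<bar>\<nu> A + \<nu>' A\<bar>) \<le> (\<Sum>A\<in>P. ennreal \<bar>\<nu> A\<bar> + ennreal \<bar>\<nu>' A\<bar>)"
    by (intro sum_mono) (auto simp: ennreal_plus[symmetric] simp del: ennreal_plus intro!: ennreal_leI)
  also have "\<dots> = (\<Sum>A\<in>P. ennreal \<bar>\<nu> A\<bar>) + (\<Sum>A\<in>P. ennreal \<bar>\<nu>' A\<bar>)" by (rule sum.distrib)
  also have "\<dots> \<le> (SUP P \<in> {P. finite P \<and> P \<subseteq> sets borel \<and> partition_on E P}. \<Sum>A\<in>P. ennreal \<bar>\<nu> A\<bar>)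
     + (SUP P \<in> {P. finite P \<and> P \<subseteq> sets borel \<and> partition_on E P}. \<Sum>A\<in>P. ennreal \<bar>\<nu>' A\<bar>)"
    by (intro add_mono SUP_upper P)
  finally show "(\<Sum>A\<in>P. ennreal \<bar>\<nu> A + \<nu>' A\<bar>) \<le> \<dots>" .
qed

lemma variation_zero: "variation (\<lambda>A. 0) E = 0"
  unfolding variation_def by (auto intro!: antisym SUP_least)

lemma variation_sum_le:
  "finite I \<Longrightarrow> variation (\<lambda>A. \<Sum>i\<in>I. \<nu> i A) E \<le> (\<Sum>i\<in>I. variation (\<nu> i) E)"
proof (induction I rule: finite_induct)
  case (insert i I)
  then show ?case
    using variation_add_le[of "\<nu> i" "\<lambda>A. \<Sum>i\<in>I. \<nu> i A" E]
    by simp (meson add_left_mono order_trans)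
qed (simp add: variation_zero)

text \<open>The common part of \<open>A\<close> and \<open>B\<close> cancels in the difference; the
  two remainders are disjoint and extend to a partition of \<open>U\<close>, which the variation
  dominates.\<close>

lemma diff_le_variation:
  assumes \<nu>: "countably_additive_on U \<nu>" and U: "U \<in> sets borel"
    and A: "A \<in> sets borel" "A \<subseteq> U" and B: "B \<in> sets borel" "B \<subseteq> U"
  shows "ennreal (\<nu> A - \<nu> B) \<le> variation \<nu> U"
proof -
  have 0: "\<nu> {} = 0" using \<nu> by (simp add: countably_additive_on_def)
  define Q where "Q = {A - B, B - A, U - (A - B) - (B - A)}"
  \<comment> \<open>\<open>partition_on\<close> forbids the empty set, and dropping it changes no
    sum because its value is 0.\<close>
  define P where "P = Q - {{}}"
  have split: "\<nu> C = \<nu> (C - D) + \<nu> (C \<inter> D)"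
    if "C \<in> sets borel" "C \<subseteq> U" "D \<in> sets borel" for C D
    using countably_additive_on_Un[OF \<nu>, of "C - D" "C \<inter> D"] that by (force simp: Un_Diff_Int)
  have "\<nu> A = \<nu> (A - B) + \<nu> (A \<inter> B)" "\<nu> B = \<nu> (B - A) + \<nu> (A \<inter> B)"
    using split[of A B] split[of B A] A B by (simp_all add: Int_commute)
  then have "ennreal (\<nu> A - \<nu> B) \<le> ennreal (\<bar>\<nu> (A - B)\<bar> + \<bar>\<nu> (B - A)\<bar>)"
    by (intro ennreal_leI) linarith
  also have "\<dots> \<le> (\<Sum>C\<in>P. ennreal \<bar>\<nu> C\<bar>)"
  proof -
    have "(\<Sum>C\<in>P. ennreal \<bar>\<nu> C\<bar>) = (\<Sum>C\<in>Q. ennreal \<bar>\<nu> C\<bar>)"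
      unfolding P_def by (rule sum.mono_neutral_left) (auto simp: Q_def 0)
    moreover have "(\<Sum>C\<in>{A - B, B - A}. ennreal \<bar>\<nu> C\<bar>) \<le> (\<Sum>C\<in>Q. ennreal \<bar>\<nu> C\<bar>)"
      by (rule sum_mono2) (auto simp: Q_def)
    moreover have "ennreal (\<bar>\<nu> (A - B)\<bar> + \<bar>\<nu> (B - A)\<bar>) = (\<Sum>C\<in>{A - B, B - A}. ennreal \<bar>\<nu> C\<bar>)"
    \<comment> \<open>If the two pieces coincide, the set of pieces collapses to one element; both
      are then empty.\<close>
    proof (cases "A - B = B - A")
      case True
      then have "A - B = {}" "B - A = {}" by blast+
      then show ?thesis by (simp add: 0)
    qed simp
    ultimately show ?thesis by simp
  qed
  also have "\<dots> \<le> variation \<nu> U"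
    unfolding variation_def
  proof (rule SUP_upper, intro CollectI conjI)
    show "finite P" by (simp add: P_def Q_def)
    show "P \<subseteq> sets borel" using A(1) B(1) U by (auto simp: P_def Q_def)
    have "\<Union>P = \<Union>Q" by (auto simp: P_def)
    also have "\<Union>Q = (A - B) \<union> (B - A) \<union> (U - (A - B) - (B - A))" by (simp add: Q_def Un_assoc)
    also have "\<dots> = U" using A(2) B(2) by blast
    finally have "\<Union>P = U" .
    moreover have "disjoint P"
    proof -
      have "pairwise disjnt Q"
        unfolding Q_def pairwise_insert by (auto simp: disjnt_def)
      then show ?thesis
        unfolding P_def disjoint_def pairwise_def disjnt_def by simp
    qed
    ultimately show "partition_on U P" by (simp add: partition_on_def P_def)
  qed
  finally show ?thesis .
qed

section \<open>Jordan parts of a signed measure and bounds for the potential\<close>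

lemma sets_positive_part: "sets (positive_part U \<nu>) = sets (restrict_space borel U)"
  and space_positive_part: "space (positive_part U \<nu>) = U"
proof -
  have "sets (restrict_space borel U) \<subseteq> Pow U" by (auto simp: sets_restrict_space)
  then show "space (positive_part U \<nu>) = U" "sets (positive_part U \<nu>) = sets (restrict_space borel U)"
    unfolding positive_part_def using sets.sigma_sets_eq[of "restrict_space borel U"]
    by (simp_all add: space_measure_of sets_measure_of space_restrict_space)
qed

text \<open>Whether the defining set function is countably additive does not matter here, because
  \<open>measure_of\<close> falls back to the zero measure.\<close>

lemma emeasure_positive_part_le:
  "emeasure (positive_part U \<nu>) U \<le> (SUP A \<in> {A \<in> sets borel. A \<subseteq> U}. ennreal (\<nu> A))"
proof -
  have "sets (restrict_space borel U) \<subseteq> Pow U" by (auto simp: sets_restrict_space)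
  then show ?thesis unfolding positive_part_def by (simp add: emeasure_measure_of_conv)
qed

text \<open>The two masses are bounded by suprema over independently chosen Borel sets, so their sum
  is controlled by the differences \<open>\<nu> A - \<nu> B\<close>.\<close>

lemma emeasure_jordan_le_variation:
  assumes \<nu>: "countably_additive_on U \<nu>" and U: "U \<in> sets borel"
  shows "emeasure (positive_part U \<nu>) U + emeasure (positive_part U (\<lambda>A. - \<nu> A)) U \<le> variation \<nu> U"
proof -
  let ?S = "{A \<in> sets borel. A \<subseteq> U}"
  have ne: "{} \<in> ?S" by simp
  have 0: "\<nu> {} = 0" using \<nu> by (simp add: countably_additive_on_def)
  have pair: "ennreal (\<nu> A) + ennreal (- \<nu> B) \<le> variation \<nu> U" if "A \<in> ?S" "B \<in> ?S" for A B
  proof -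
    have v: "ennreal (\<nu> A' - \<nu> B') \<le> variation \<nu> U" if "A' \<in> ?S" "B' \<in> ?S" for A' B'
      using diff_le_variation[OF \<nu> U] that by blast
    \<comment> \<open>A set with the wrong sign is replaced by the empty set, which mirrors the
      truncation of negative values by \<open>ennreal\<close>.\<close>
    define A' B' where "A' = (if \<nu> A \<ge> 0 then A else {})" and "B' = (if \<nu> B \<le> 0 then B else {})"
    have "ennreal (\<nu> A) + ennreal (- \<nu> B) = ennreal (\<nu> A' - \<nu> B')"
      by (auto simp: A'_def B'_def 0 ennreal_neg ennreal_plus[symmetric] simp del: ennreal_plus)
    also have "\<dots> \<le> variation \<nu> U" by (rule v) (use that in \<open>auto simp: A'_def B'_def\<close>)
    finally show ?thesis .
  qed
  have "emeasure (positive_part U \<nu>) U + emeasure (positive_part U (\<lambda>A. - \<nu> A)) U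
     \<le> (SUP A \<in> ?S. ennreal (\<nu> A)) + (SUP B \<in> ?S. ennreal (- \<nu> B))"
    by (intro add_mono emeasure_positive_part_le)
  also have "\<dots> = (SUP B \<in> ?S. (SUP A \<in> ?S. ennreal (\<nu> A)) + ennreal (- \<nu> B))"
    using ne by (intro ennreal_SUP_add_right) blast
  also have "\<dots> = (SUP B \<in> ?S. SUP A \<in> ?S. ennreal (\<nu> A) + ennreal (- \<nu> B))"
    using ne by (intro SUP_cong refl ennreal_SUP_add_left[symmetric]) auto
  also have "\<dots> \<le> variation \<nu> U" by (intro SUP_least pair)
  finally show ?thesis .
qed

lemma finite_measure_positive_part:
  assumes "emeasure (positive_part U \<nu>) U < \<infinity>"
  shows "finite_measure (positive_part U \<nu>)"
  using assms by (intro finite_measureI) (simp add: space_positive_part)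

lemma abs_integral_positive_part_le:
  assumes fin: "emeasure (positive_part U \<nu>) U < \<infinity>"
    and B: "\<And>y. \<bar>\<phi> y\<bar> \<le> B"
  shows "\<bar>LINT y|positive_part U \<nu>. \<phi> y\<bar> \<le> B * measure (positive_part U \<nu>) U"
proof (cases "integrable (positive_part U \<nu>) \<phi>")
  case True
  interpret finite_measure "positive_part U \<nu>" by (rule finite_measure_positive_part[OF fin])
  have "\<bar>LINT y|positive_part U \<nu>. \<phi> y\<bar> \<le> (LINT y|positive_part U \<nu>. \<bar>\<phi> y\<bar>)"
    by (rule integral_abs_bound)
  also have "\<dots> \<le> (LINT y|positive_part U \<nu>. B)"
    using True B by (intro integral_mono) auto
  finally show ?thesis by (simp add: space_positive_part mult.commute)
next
  case False
  \<comment> \<open>Without integrability the integral has the default value 0, so a nonnegative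
    bound is enough.\<close>
  have "B \<ge> 0" using B[of undefined] by linarith
  with False show ?thesis by (simp add: not_integrable_integral_eq)
qed

lemma abs_potential_le:
  assumes \<nu>: "countably_additive_on U \<nu>" and U: "U \<in> sets borel"
    and v: "variation \<nu> U \<le> ennreal c" and c: "c \<ge> 0" and B: "\<And>y. \<bar>f y\<bar> \<le> B"
  shows "\<bar>potential U f \<nu> x\<bar> \<le> B * c"
proof -
  let ?p = "positive_part U \<nu>" and ?n = "positive_part U (\<lambda>A. - \<nu> A)"
  have sum: "emeasure ?p U + emeasure ?n U \<le> ennreal c"
    using emeasure_jordan_le_variation[OF \<nu> U] v by (rule order_trans)
  then have fin: "emeasure ?p U < \<infinity>" "emeasure ?n U < \<infinity>"
    by (metis add_increasing2 add_increasing ennreal_less_top infinity_ennreal_def order_le_less_trans zero_le order_refl)+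
  have "ennreal (measure ?p U + measure ?n U) \<le> ennreal c"
    using sum fin by (simp add: emeasure_eq_ennreal_measure less_top[symmetric] ennreal_plus)
  then have m: "measure ?p U + measure ?n U \<le> c" unfolding ennreal_le_iff[OF c] .
  have "\<bar>potential U f \<nu> x\<bar> \<le> B * measure ?p U + B * measure ?n U"
    unfolding potential_def signed_integral_def
    using abs_integral_positive_part_le[OF fin(1), of "\<lambda>y. f (x - y)" B]
      abs_integral_positive_part_le[OF fin(2), of "\<lambda>y. f (x - y)" B] B by force
  also have "\<dots> \<le> B * c"
  proof -
    have "B \<ge> 0" using B[of undefined] by linarith
    then show ?thesis using mult_left_mono[OF m, of B] by (simp add: algebra_simps)
  qed
  finally show ?thesis .
qed

lemma borel_measurable_integral_positive_part:
  fixes f :: "'a::euclidean_space \<Rightarrow> real"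
  assumes fin: "emeasure (positive_part U \<nu>) U < \<infinity>" and f: "f \<in> borel_measurable borel"
  shows "(\<lambda>x. LINT y|positive_part U \<nu>. f (x - y)) \<in> borel_measurable borel"
proof -
  interpret finite_measure "positive_part U \<nu>" by (rule finite_measure_positive_part[OF fin])
  have "(\<lambda>y. y) \<in> measurable (positive_part U \<nu>) borel"
    using measurable_restrict_space1[of "\<lambda>y. y" borel borel U]
    by (simp cong: measurable_cong_sets add: sets_positive_part)
  then have "(\<lambda>w. snd w) \<in> measurable (borel \<Otimes>\<^sub>M positive_part U \<nu>) borel"
    by (rule measurable_compose[OF measurable_snd])
  then have "(\<lambda>w. f (fst w - snd w)) \<in> borel_measurable (borel \<Otimes>\<^sub>M positive_part U \<nu>)"
    by (intro measurable_compose[OF _ f] borel_measurable_diff measurable_fst)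
  then have "(\<lambda>(x, y). f (x - y)) \<in> borel_measurable (borel \<Otimes>\<^sub>M positive_part U \<nu>)"
    by (simp add: split_beta')
  then show ?thesis by (rule borel_measurable_lebesgue_integral)
qed

lemma borel_measurable_potential:
  fixes f :: "'a::euclidean_space \<Rightarrow> real"
  assumes \<nu>: "countably_additive_on U \<nu>" and U: "U \<in> sets borel"
    and v: "variation \<nu> U < \<infinity>" and f: "f \<in> borel_measurable borel"
  shows "potential U f \<nu> \<in> borel_measurable borel"
proof -
  let ?p = "positive_part U \<nu>" and ?n = "positive_part U (\<lambda>A. - \<nu> A)"
  have "emeasure ?p U + emeasure ?n U < \<infinity>"
    using emeasure_jordan_le_variation[OF \<nu> U] v by (rule le_less_trans)
  then have "emeasure ?p U < \<infinity>" "emeasure ?n U < \<infinity>"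
    by (auto simp: less_top)
  then show ?thesis
    unfolding potential_def signed_integral_def
    by (intro borel_measurable_diff borel_measurable_integral_positive_part f)
qed

text \<open>The variation is a supremum over uncountably many partitions, so measurability is not
  read off from the definition. As a function of the coefficients, however, it satisfies a Lipschitz
  estimate in the first \<open>k\<close> coordinates; it is thus continuous on the product space and
  can be composed with the random coefficients.\<close>

lemma borel_measurable_variation_partial_sum:
  fixes \<mu> :: "nat \<Rightarrow> 'a::euclidean_space set \<Rightarrow> real"
  assumes a: "\<And>j. j \<ge> 1 \<Longrightarrow> a j \<in> borel_measurable M"
    and \<mu>: "\<And>j. j \<ge> 1 \<Longrightarrow> variation (\<mu> j) U < \<infinity>"
  shows "(\<lambda>\<omega>. variation (partial_sum a \<mu> k \<omega>) U) \<in> borel_measurable M"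
proof -
  define m where "m j = enn2real (variation (\<mu> j) U)" for j
  have m: "variation (\<mu> j) U = ennreal (m j)" if "j \<ge> 1" for j
    using \<mu>[OF that] by (simp add: m_def)
  have m0: "m j \<ge> 0" for j by (simp add: m_def)
  define S where "S t = (\<lambda>A. \<Sum>j=1..k. t j * \<mu> j A)" for t :: "nat \<Rightarrow> real"
  have bound: "variation (S t) U \<le> ennreal (\<Sum>j=1..k. \<bar>t j\<bar> * m j)" for t
  proof -
    have "variation (S t) U \<le> (\<Sum>j=1..k. variation (\<lambda>A. t j * \<mu> j A) U)"
      unfolding S_def by (rule variation_sum_le) simp
    also have "\<dots> = (\<Sum>j=1..k. ennreal (\<bar>t j\<bar> * m j))"
      by (intro sum.cong) (auto simp: variation_cmult m ennreal_mult m0)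
    finally show ?thesis by (simp add: m0 sum_ennreal)
  qed
  define v where "v t = enn2real (variation (S t) U)" for t
  have v: "variation (S t) U = ennreal (v t)" for t
    using bound[of t] by (simp add: v_def le_less_trans[OF _ ennreal_less_top])
  have v0: "v t \<ge> 0" for t by (simp add: v_def)
  have tri: "v t \<le> v t' + (\<Sum>j=1..k. \<bar>t j - t' j\<bar> * m j)" for t t'
  proof -
    have "S t = (\<lambda>A. S t' A + S (\<lambda>j. t j - t' j) A)"
      by (auto simp: S_def sum.distrib[symmetric] algebra_simps)
    then have "variation (S t) U \<le> variation (S t') U + variation (S (\<lambda>j. t j - t' j)) U"
      using variation_add_le[of "S t'" "S (\<lambda>j. t j - t' j)" U] by simp
    also have "\<dots> \<le> ennreal (v t') + ennreal (\<Sum>j=1..k. \<bar>t j - t' j\<bar> * m j)"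
      using bound[of "\<lambda>j. t j - t' j"] by (simp add: v add_left_mono)
    also have "\<dots> = ennreal (v t' + (\<Sum>j=1..k. \<bar>t j - t' j\<bar> * m j))"
      using v0 m0 by (simp add: ennreal_plus sum_nonneg)
    finally show ?thesis unfolding v
      by (subst (asm) ennreal_le_iff) (auto intro!: add_nonneg_nonneg sum_nonneg mult_nonneg_nonneg v0 m0)
  qed
  have "isCont v t" for t
    unfolding isCont_def
  proof (rule LIM_zero_cancel, rule Lim_transform_bound)
    have c: "((\<lambda>s. s j) \<longlongrightarrow> t j) (at t)" for j
      using continuous_on_eq_continuous_at[OF open_UNIV, THEN iffD1,
          OF continuous_on_product_coordinates[of j]]
      by (auto simp: isCont_def)
    have "((\<lambda>s. \<Sum>j=1..k. \<bar>s j - t j\<bar> * m j) \<longlongrightarrow> (\<Sum>j=1..k. \<bar>t j - t j\<bar> * m j)) (at t)"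
      by (intro tendsto_sum tendsto_mult tendsto_rabs tendsto_diff tendsto_const c)
    then show "((\<lambda>s. \<Sum>j=1..k. \<bar>s j - t j\<bar> * m j) \<longlongrightarrow> 0) (at t)" by simp
    show "\<forall>\<^sub>F s in at t. norm (v s - v t) \<le> norm (\<Sum>j=1..k. \<bar>s j - t j\<bar> * m j)"
    proof (rule always_eventually, rule allI)
      fix s
      have "(\<Sum>j=1..k. \<bar>s j - t j\<bar> * m j) \<ge> 0" by (intro sum_nonneg) (simp add: m0)
      moreover have "(\<Sum>j=1..k. \<bar>t j - s j\<bar> * m j) = (\<Sum>j=1..k. \<bar>s j - t j\<bar> * m j)"
        by (simp add: abs_minus_commute)
      ultimately show "norm (v s - v t) \<le> norm (\<Sum>j=1..k. \<bar>s j - t j\<bar> * m j)"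
        using tri[of s t] tri[of t s] by simp
    qed
  qed
  then have vm: "v \<in> borel_measurable borel"
    by (intro borel_measurable_continuous_onI continuous_at_imp_continuous_on) auto
  define a' where "a' \<omega> j = (if j \<ge> 1 then a j \<omega> else 0)" for \<omega> j
  have "a' \<in> borel_measurable M"
  proof (rule measurable_coordinatewise_then_product)
    show "(\<lambda>\<omega>. a' \<omega> j) \<in> borel_measurable M" for j
      using a[of j] by (cases "j \<ge> 1") (simp_all add: a'_def)
  qed
  then have "(\<lambda>\<omega>. ennreal (v (a' \<omega>))) \<in> borel_measurable M"
    using measurable_compose[OF _ vm] by (intro measurable_compose[OF _ measurable_ennreal]) blast
  also have "(\<lambda>\<omega>. ennreal (v (a' \<omega>))) = (\<lambda>\<omega>. variation (partial_sum a \<mu> k \<omega>) U)"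
  proof
    fix \<omega>
    have "S (a' \<omega>) = partial_sum a \<mu> k \<omega>"
      unfolding S_def partial_sum_def a'_def by (intro ext sum.cong) auto
    then show "ennreal (v (a' \<omega>)) = variation (partial_sum a \<mu> k \<omega>) U" by (simp add: v[symmetric])
  qed
  finally show ?thesis .
qed

text \<open>Triangle inequality, then passage to the limit. The shift by \<open>Suc\<close> matches
  events that are numbered from the first partial sum on.\<close>

lemma variation_limit_le:
  assumes lim: "(\<lambda>k. variation (\<lambda>A. S k A - \<nu> A) U) \<longlonglongrightarrow> 0"
    and ev: "eventually (\<lambda>k. variation (S (Suc k)) U \<le> c) sequentially"
  shows "variation \<nu> U \<le> c"
proof -
  have "variation \<nu> U \<le> variation (S k) U + variation (\<lambda>A. S k A - \<nu> A) U" for k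
  proof -
    have "variation (\<lambda>A. - 1 * (S k A - \<nu> A)) U = variation (\<lambda>A. S k A - \<nu> A) U"
      unfolding variation_cmult by simp
    then show ?thesis
      using variation_add_le[of "S k" "\<lambda>A. - 1 * (S k A - \<nu> A)" U] by simp
  qed
  then have "eventually (\<lambda>k. variation \<nu> U \<le> c + variation (\<lambda>A. S (Suc k) A - \<nu> A) U) sequentially"
    using ev by (elim eventually_mono) (meson add_right_mono order_trans)
  moreover have "(\<lambda>k. c + variation (\<lambda>A. S (Suc k) A - \<nu> A) U) \<longlonglongrightarrow> c + 0"
    by (intro tendsto_add tendsto_const LIMSEQ_Suc lim)
  ultimately show ?thesis
    using tendsto_lowerbound[of "\<lambda>k. c + variation (\<lambda>A. S (Suc k) A - \<nu> A) U" "c + 0" sequentially "variation \<nu> U"]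
    by simp
qed

section \<open>Existence of integral solutions\<close>

lemma powr_diff_le:
  fixes s t p :: real
  assumes p: "p > 1" and st: "0 \<le> s" "s \<le> t" "t \<le> r"
  shows "t powr p - s powr p \<le> p * r powr (p - 1) * (t - s)"
proof (cases "s = t")
  case False
  with st have lt: "s < t" by simp
  have d: "((\<lambda>x. x powr p) has_real_derivative p * x powr (p - 1)) (at x)" if "s < x" for x
    using has_real_derivative_powr[of x p] that st by simp
  have "\<exists>l z. s < z \<and> z < t \<and> ((\<lambda>x. x powr p) has_real_derivative l) (at z) \<and>
      t powr p - s powr p = (t - s) * l"
  proof (rule MVT[OF lt])
    show "continuous_on {s..t} (\<lambda>x. x powr p)"
      by (rule continuous_on_powr') (use st p in \<open>auto intro!: continuous_intros\<close>)
    show "(\<lambda>x. x powr p) differentiable at x" if "s < x" "x < t" for x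
      using d[OF that(1)] real_differentiable_def by blast
  qed
  then obtain l z where z: "s < z" "z < t" "((\<lambda>x. x powr p) has_real_derivative l) (at z)"
    and eq: "t powr p - s powr p = (t - s) * l" by blast
  have "l = p * z powr (p - 1)" using DERIV_unique[OF z(3) d[OF z(1)]] .
  also have "\<dots> \<le> p * r powr (p - 1)"
    using z st p by (intro mult_left_mono powr_mono2) auto
  finally have "(t - s) * l \<le> (t - s) * (p * r powr (p - 1))"
    using lt by (intro mult_left_mono) auto
  then show ?thesis unfolding eq by (simp add: mult.commute)
qed simp

text \<open>The map is odd, so equal signs reduce to the mean value estimate on nonnegative numbers.
  For opposite signs the path is split at 0, where the distances from \<open>s\<close> and from
  \<open>t\<close> add up to the distance between them.\<close>

lemma abs_mult_powr_diff_le: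
  fixes s t p :: real
  assumes p: "p > 1" and s: "\<bar>s\<bar> \<le> r" and t: "\<bar>t\<bar> \<le> r"
  shows "\<bar>s * \<bar>s\<bar> powr (p - 1) - t * \<bar>t\<bar> powr (p - 1)\<bar> \<le> p * r powr (p - 1) * \<bar>s - t\<bar>"
proof -
  define F where "F = (\<lambda>s::real. s * \<bar>s\<bar> powr (p - 1))"
  have Fpos: "F s = s powr p" if "s \<ge> 0" for s
    using that powr_mult_base[of s "p - 1"] by (simp add: F_def)
  have Fneg: "F (- s) = - F s" for s by (simp add: F_def)
  have mono: "\<bar>F s - F t\<bar> \<le> p * r powr (p - 1) * \<bar>s - t\<bar>" if "0 \<le> s" "s \<le> t" "t \<le> r" for s t
  proof -
    have "s powr p \<le> t powr p" using that p by (intro powr_mono2) auto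
    then show ?thesis using powr_diff_le[OF p that] that by (simp add: Fpos)
  qed
  have pos: "\<bar>F s - F t\<bar> \<le> p * r powr (p - 1) * \<bar>s - t\<bar>" if "0 \<le> s" "0 \<le> t" "s \<le> r" "t \<le> r" for s t
    using mono[of s t] mono[of t s] that by (cases "s \<le> t") (auto simp: abs_minus_commute)
  have mixed: "\<bar>F s - F t\<bar> \<le> p * r powr (p - 1) * \<bar>s - t\<bar>" if "s \<le> 0" "0 \<le> t" "- s \<le> r" "t \<le> r" for s t
  proof -
    have F0: "F 0 = 0" by (simp add: F_def)
    have "\<bar>F s - F t\<bar> \<le> \<bar>F 0 - F (- s)\<bar> + \<bar>F 0 - F t\<bar>" by (simp add: F0 Fneg)
    also have "\<dots> \<le> p * r powr (p - 1) * (- s) + p * r powr (p - 1) * t"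
      using pos[of 0 "- s"] pos[of 0 t] that by simp
    also have "\<dots> = p * r powr (p - 1) * \<bar>s - t\<bar>" using that by (simp add: algebra_simps)
    finally show ?thesis .
  qed
  have "\<bar>F s - F t\<bar> \<le> p * r powr (p - 1) * \<bar>s - t\<bar>"
  proof (cases "s \<ge> 0"; cases "t \<ge> 0")
    assume "\<not> s \<ge> 0" "\<not> t \<ge> 0"
    then show ?thesis using pos[of "- s" "- t"] s t by (simp add: Fneg abs_minus_commute)
  next
    assume "s \<ge> 0" "\<not> t \<ge> 0"
    then show ?thesis using mixed[of t s] s t by (simp add: abs_minus_commute)
  qed (use pos[of s t] mixed[of s t] s t in auto)
  then show ?thesis by (simp add: F_def)
qed

text \<open>Banach's fixed-point argument for the supremum norm, with the norm replaced by uniform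
  bounds \<delta>. Pointwise limits of the iterates stay measurable, and the resulting equation
  holds at every point of the space.\<close>

lemma bounded_measurable_contraction_fixpoint:
  fixes T :: "('a \<Rightarrow> real) \<Rightarrow> 'a \<Rightarrow> real" and r q :: real and N :: "'a measure"
  defines "X \<equiv> {u \<in> borel_measurable N. \<forall>x\<in>space N. \<bar>u x\<bar> \<le> r}"
  assumes r: "r \<ge> 0" and q: "0 \<le> q" "q < 1"
    and T: "\<And>u. u \<in> X \<Longrightarrow> T u \<in> X"
    and contr: "\<And>u v \<delta>. u \<in> X \<Longrightarrow> v \<in> X \<Longrightarrow> \<delta> \<ge> 0 \<Longrightarrow> (\<And>x. x \<in> space N \<Longrightarrow> \<bar>u x - v x\<bar> \<le> \<delta>) \<Longrightarrow>
      (\<And>x. x \<in> space N \<Longrightarrow> \<bar>T u x - T v x\<bar> \<le> q * \<delta>)"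
  shows "\<exists>u\<in>X. \<forall>x\<in>space N. u x = T u x"
proof -
  define u where "u k = (T ^^ k) (\<lambda>_. 0)" for k
  have uS: "u (Suc k) = T (u k)" for k by (simp add: u_def)
  have uX: "u k \<in> X" for k
  proof (induction k)
    case 0
    then show ?case using r by (simp add: u_def X_def)
  qed (simp add: uS T)
  \<comment> \<open>As the iteration starts at 0 and all iterates are bounded by \<open>r\<close>,
    the case \<open>k = 0\<close> is immediate for every \<open>j\<close>; contraction then gives
    the rate directly, with no geometric series.\<close>
  have diff: "\<bar>u (k + j) x - u k x\<bar> \<le> q ^ k * r" if "x \<in> space N" for k j x
    using that
  proof (induction k arbitrary: x)
    case 0
    then show ?case using uX[of j] by (simp add: X_def) (simp add: u_def)
  next
    case (Suc k)
    show ?case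
      using contr[OF uX uX _ Suc.IH Suc.prems] q r by (simp add: uS mult.assoc)
  qed
  have qr: "(\<lambda>k. q ^ k * r) \<longlonglongrightarrow> 0"
    using tendsto_mult_left_zero[OF LIMSEQ_realpow_zero[OF q]] .
  have conv: "convergent (\<lambda>k. u k x)" if x: "x \<in> space N" for x
    unfolding Cauchy_convergent_iff[symmetric]
  proof (rule metric_CauchyI)
    fix e :: real assume "e > 0"
    then obtain k where k: "q ^ k * r < e / 2"
      using order_tendstoD(2)[OF qr, of "e / 2"] by (auto dest: eventually_happens)
    have "dist (u m x) (u n x) < e" if "m \<ge> k" "n \<ge> k" for m n
      using diff[OF x, of k "m - k"] diff[OF x, of k "n - k"] k that by (simp add: dist_real_def)
    then show "\<exists>M. \<forall>m\<ge>M. \<forall>n\<ge>M. dist (u m x) (u n x) < e" by blast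
  qed
  define w where "w x = lim (\<lambda>k. u k x)" for x
  have lim: "(\<lambda>k. u k x) \<longlonglongrightarrow> w x" if "x \<in> space N" for x
    using conv[OF that] by (simp add: w_def convergent_LIMSEQ_iff)
  have near: "\<bar>w x - u k x\<bar> \<le> q ^ k * r" if x: "x \<in> space N" for x k
  proof (rule Lim_bounded)
    show "(\<lambda>j. \<bar>u (j + k) x - u k x\<bar>) \<longlonglongrightarrow> \<bar>w x - u k x\<bar>"
      by (intro tendsto_intros LIMSEQ_ignore_initial_segment lim x)
    show "\<forall>j\<ge>0. \<bar>u (j + k) x - u k x\<bar> \<le> q ^ k * r" using diff[OF x, of k] by (simp add: add.commute[of _ k])
  qed
  have wX: "w \<in> X"
  proof -
    have "u k \<in> borel_measurable N" for k using uX[of k] by (simp add: X_def)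
    then have "w \<in> borel_measurable N" by (rule borel_measurable_LIMSEQ_metric[OF _ lim])
    moreover have "\<bar>w x\<bar> \<le> r" if "x \<in> space N" for x using near[OF that, of 0] by (simp add: u_def)
    ultimately show ?thesis by (simp add: X_def)
  qed
  have "w x = T w x" if x: "x \<in> space N" for x
  proof (rule LIMSEQ_unique)
    show "(\<lambda>k. u (Suc k) x) \<longlonglongrightarrow> w x" using lim[OF x] by (rule LIMSEQ_Suc)
    have "(\<lambda>k. u (Suc k) x - T w x) \<longlonglongrightarrow> 0"
    proof (rule Lim_transform_bound)
      show "(\<lambda>k. q * (q ^ k * r)) \<longlonglongrightarrow> 0" using tendsto_mult_right_zero[OF qr] .
      show "\<forall>\<^sub>F k in sequentially. norm (u (Suc k) x - T w x) \<le> norm (q * (q ^ k * r))"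
      proof (rule always_eventually, rule allI)
        fix k
        have "\<bar>T w x - T (u k) x\<bar> \<le> q * (q ^ k * r)"
          by (rule contr[OF wX uX _ near x]) (use q r in auto)
        then show "norm (u (Suc k) x - T w x) \<le> norm (q * (q ^ k * r))"
          by (simp add: uS abs_minus_commute)
      qed
    qed
    then show "(\<lambda>k. u (Suc k) x) \<longlonglongrightarrow> T w x" by (simp add: LIM_zero_iff)
  qed
  with wX show ?thesis by blast
qed

text \<open>The deterministic core, applied to one realisation of the potential at a time. Here
  \<open>\<beta>\<close>, \<open>\<Gamma>\<close> and \<open>W\<close> bound \<open>b\<close>,
  \<open>g\<close> and \<open>V\<close>, and \<open>small\<close> bounds \<open>l0 U\<close> times
  the Lipschitz constant of the power term on the ball by 1/2.\<close>

lemma exists_integral_solution: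
  fixes U :: "'a::euclidean_space set"
  assumes n: "DIM('a) \<ge> 3" and U: "open U" "bounded U" and p: "p > 1"
    and b: "b \<in> borel_measurable (lebesgue_on U)" "AE x in lebesgue_on U. \<bar>b x\<bar> \<le> \<beta>" "\<beta> \<ge> 0"
    and g: "g \<in> borel_measurable (lebesgue_on U)" "AE x in lebesgue_on U. \<bar>g x\<bar> \<le> \<Gamma>" "\<Gamma> \<ge> 0"
    and V: "V \<in> borel_measurable (lebesgue_on U)" "\<And>x. \<bar>V x\<bar> \<le> W" "l0 U * W \<le> 1"
    and small: "l0 U * \<beta> * p * (2 * l0 U * \<Gamma>) powr (p - 1) \<le> 1 / 2"
  shows "\<exists>u. integral_solution U p V b g u"
proof -
  let ?N = "lebesgue_on U" and ?L = "l0 U"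
  have L: "?L \<ge> 0" by (rule l0_nonneg[OF n])
  have W: "W \<ge> 0" using V(2)[of undefined] by linarith
  define r where "r = 2 * ?L * \<Gamma>"
  have r: "r \<ge> 0" using L g(3) by (simp add: r_def)
  define \<beta>' where "\<beta>' = \<beta> * (p * r powr (p - 1))"
  have \<beta>': "\<beta>' \<ge> 0" "?L * \<beta>' \<le> 1 / 2"
    using b(3) p small by (simp_all add: \<beta>'_def r_def mult.assoc)
  define F where "F = (\<lambda>u y. b y * u y * \<bar>u y :: real\<bar> powr (p - 1))"
  define T where "T = (\<lambda>u x. green_operator U g x - green_operator U (\<lambda>y. V y * u y) x
       + green_operator U (F u) x)"
  define X where "X = {u \<in> borel_measurable ?N. \<forall>x\<in>space ?N. \<bar>u x\<bar> \<le> r}"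
  have Xm: "u \<in> borel_measurable ?N" and Xb: "y \<in> U \<Longrightarrow> \<bar>u y\<bar> \<le> r" if "u \<in> X" for u y
    using that by (auto simp: X_def)
  have Vm: "(\<lambda>y. V y * u y) \<in> borel_measurable ?N" if "u \<in> X" for u
    using V(1) Xm[OF that] by (rule borel_measurable_times)
  have Fm: "F u \<in> borel_measurable ?N" if "u \<in> X" for u
  proof -
    have [measurable]: "u \<in> borel_measurable ?N" "b \<in> borel_measurable ?N" using Xm[OF that] b(1) .
    show ?thesis unfolding F_def by measurable
  qed
  have VB: "\<bar>V y * u\<bar> \<le> W * \<delta>" if "\<bar>u\<bar> \<le> \<delta>" for y u \<delta>
    unfolding abs_mult using that V(2) W by (intro mult_mono) auto
  have FB: "AE y in ?N. \<bar>F u y - F v y\<bar> \<le> \<beta>' * \<delta>"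
    if u: "u \<in> X" and v: "v \<in> X" and \<delta>: "\<And>y. y \<in> U \<Longrightarrow> \<bar>u y - v y\<bar> \<le> \<delta>" for u v \<delta>
    using b(2) AE_space
  proof eventually_elim
    case (elim y)
    then have y: "y \<in> U" by simp
    have "\<bar>F u y - F v y\<bar> = \<bar>b y\<bar> * \<bar>u y * \<bar>u y\<bar> powr (p - 1) - v y * \<bar>v y\<bar> powr (p - 1)\<bar>"
      unfolding abs_mult[symmetric] by (simp add: F_def algebra_simps)
    also have "\<dots> \<le> \<beta> * (p * r powr (p - 1) * \<bar>u y - v y\<bar>)"
      using elim(1) b(3) by (intro mult_mono abs_mult_powr_diff_le[OF p] Xb u v y) auto
    also have "\<dots> \<le> \<beta> * (p * r powr (p - 1) * \<delta>)"
      using \<delta>[OF y] b(3) p by (intro mult_left_mono) auto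
    finally show ?case by (simp add: \<beta>'_def mult.assoc)
  qed
  have zX: "(\<lambda>_. 0) \<in> X" using r by (simp add: X_def)
  \<comment> \<open>The size estimate is the Lipschitz estimate against the zero function.\<close>
  have F0: "AE y in ?N. \<bar>F u y\<bar> \<le> \<beta>' * r" if u: "u \<in> X" for u
    using FB[OF u zX, of r] Xb[OF u] by (simp add: F_def)
  have V0: "AE y in ?N. \<bar>V y * u y\<bar> \<le> W * r" if u: "u \<in> X" for u
    using AE_space by eventually_elim (use VB Xb[OF u] in auto)
  \<comment> \<open>The shares of the potential term and the power term, in the self-map with
    \<delta> = \<open>r\<close> and in the contraction alike.\<close>
  have half: "?L / 2 * (W * \<delta>) \<le> \<delta> / 2" "?L / 2 * (\<beta>' * \<delta>) \<le> \<delta> / 4" if "\<delta> \<ge> 0" for \<delta>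
    using mult_right_mono[OF V(3) that] mult_right_mono[OF \<beta>'(2) that] by (simp_all add: mult_ac)
  have "\<exists>u\<in>X. \<forall>x\<in>space ?N. u x = T u x"
    unfolding X_def
  proof (rule bounded_measurable_contraction_fixpoint[where q = "3 / 4"])
    show "T u \<in> {u \<in> borel_measurable ?N. \<forall>x\<in>space ?N. \<bar>u x\<bar> \<le> r}"
      if "u \<in> {u \<in> borel_measurable ?N. \<forall>x\<in>space ?N. \<bar>u x\<bar> \<le> r}" for u
    proof -
      have u: "u \<in> X" using that by (simp add: X_def)
      have "T u \<in> borel_measurable ?N"
        unfolding T_def
        by (intro borel_measurable_add borel_measurable_diff borel_measurable_green_operator[OF n U]
            g Vm Fm u)
      moreover have "\<bar>T u x\<bar> \<le> r" if x: "x \<in> U" for x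
      proof -
        have "\<bar>green_operator U g x\<bar> \<le> r / 4"
          using abs_green_operator_le[OF n U x g] by (simp add: r_def mult.commute)
        moreover have "\<bar>green_operator U (\<lambda>y. V y * u y) x\<bar> \<le> r / 2"
          using abs_green_operator_le[OF n U x Vm[OF u] V0[OF u] mult_nonneg_nonneg[OF W r]] half(1)[OF r]
          by (rule order_trans)
        moreover have "\<bar>green_operator U (F u) x\<bar> \<le> r / 4"
          using abs_green_operator_le[OF n U x Fm[OF u] F0[OF u] mult_nonneg_nonneg[OF \<beta>'(1) r]] half(2)[OF r]
          by (rule order_trans)
        ultimately show ?thesis by (simp add: T_def)
      qed
      ultimately show ?thesis by simp
    qed
    show "\<bar>T u x - T v x\<bar> \<le> 3 / 4 * \<delta>"
      if "u \<in> {u \<in> borel_measurable ?N. \<forall>x\<in>space ?N. \<bar>u x\<bar> \<le> r}"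
        and "v \<in> {u \<in> borel_measurable ?N. \<forall>x\<in>space ?N. \<bar>u x\<bar> \<le> r}"
        and \<delta>: "\<delta> \<ge> 0" and uv: "\<And>x. x \<in> space ?N \<Longrightarrow> \<bar>u x - v x\<bar> \<le> \<delta>" and x: "x \<in> space ?N" for u v \<delta> x
    proof -
      have u: "u \<in> X" and v: "v \<in> X" using that by (simp_all add: X_def)
      have x: "x \<in> U" using x by simp
      have uv: "\<bar>u y - v y\<bar> \<le> \<delta>" if "y \<in> U" for y using uv that by simp
      have "green_operator U (\<lambda>y. V y * u y) x - green_operator U (\<lambda>y. V y * v y) x
          = green_operator U (\<lambda>y. V y * u y - V y * v y) x"
        unfolding green_operator_def right_diff_distrib
        by (intro Bochner_Integration.integral_diff[symmetric]
            integrable_green_mult[OF n U x Vm V0 mult_nonneg_nonneg[OF W r]] u v)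
      moreover have "\<bar>green_operator U (\<lambda>y. V y * u y - V y * v y) x\<bar> \<le> \<delta> / 2"
      proof -
        have "AE y in ?N. \<bar>V y * u y - V y * v y\<bar> \<le> W * \<delta>"
          using AE_space
          by eventually_elim (use VB uv in \<open>auto simp: right_diff_distrib[symmetric]\<close>)
        from abs_green_operator_le[OF n U x borel_measurable_diff[OF Vm[OF u] Vm[OF v]] this
            mult_nonneg_nonneg[OF W \<delta>]] half(1)[OF \<delta>]
        show ?thesis by (rule order_trans)
      qed
      moreover have "green_operator U (F u) x - green_operator U (F v) x
          = green_operator U (\<lambda>y. F u y - F v y) x"
        unfolding green_operator_def right_diff_distrib
        by (intro Bochner_Integration.integral_diff[symmetric]
            integrable_green_mult[OF n U x Fm F0 mult_nonneg_nonneg[OF \<beta>'(1) r]] u v)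
      moreover have "\<bar>green_operator U (\<lambda>y. F u y - F v y) x\<bar> \<le> \<delta> / 4"
        using abs_green_operator_le[OF n U x borel_measurable_diff[OF Fm[OF u] Fm[OF v]] FB[OF u v uv]
            mult_nonneg_nonneg[OF \<beta>'(1) \<delta>]] half(2)[OF \<delta>]
        by (rule order_trans)
      ultimately show ?thesis unfolding T_def by linarith
    qed
  qed (use r in auto)
  then obtain u where u: "u \<in> X" "\<And>x. x \<in> U \<Longrightarrow> u x = T u x" by auto
  have "esssup ?N (\<lambda>x. ereal \<bar>u x\<bar>) \<le> ereal r"
  proof (rule esssup_I)
    show "(\<lambda>x. ereal \<bar>u x\<bar>) \<in> borel_measurable ?N" using Xm[OF u(1)] by measurable
    show "AE x in ?N. ereal \<bar>u x\<bar> \<le> ereal r" using AE_space by eventually_elim (use Xb[OF u(1)] in auto)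
  qed
  then have "u \<in> linf_space U"
    using Xm[OF u(1)] by (auto simp: linf_space_def elim: le_less_trans)
  moreover have "AE x in ?N. u x = T u x" using AE_space by eventually_elim (use u(2) in auto)
  ultimately show ?thesis unfolding integral_solution_def T_def F_def by blast
qed

text \<open>\<open>real_of_ereal\<close> sends both infinities to 0, so they must be ruled out: plus
  infinity by membership in \<open>linf_space\<close>, minus infinity because it cannot bound an
  absolute value.\<close>

lemma AE_abs_le_linf_norm:
  assumes "u \<in> linf_space U"
  shows "AE x in lebesgue_on U. \<bar>u x\<bar> \<le> linf_norm U u"
  using esssup_AE[of "\<lambda>x. ereal \<bar>u x\<bar>" "lebesgue_on U"]
proof eventually_elim
  case (elim x)
  with assms show ?case
    by (cases "esssup (lebesgue_on U) (\<lambda>x. ereal \<bar>u x\<bar>)") (auto simp: linf_norm_def linf_space_def)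
qed

text \<open>Ensures that \<open>l0 U\<close> is positive, so that divisions by it are
  genuine.\<close>

lemma diameter_pos_open:
  fixes U :: "'a::euclidean_space set"
  assumes "open U" "bounded U" "U \<noteq> {}"
  shows "diameter U > 0"
proof -
  obtain x e where e: "e > 0" "ball x e \<subseteq> U" using assms open_contains_ball by blast
  obtain v :: 'a where v: "norm v = e / 2" using vector_choose_size[of "e / 2"] e by auto
  have "x \<in> U" "x + v \<in> U" using e v by (auto simp: subset_iff dist_norm)
  then have "dist x (x + v) \<le> diameter U" by (intro diameter_bounded_bound assms)
  then show ?thesis using v e by (simp add: dist_norm)
qed

theorem theorem3p4:
  fixes U :: "(real ^ 'n) set"
    and p c K :: real
    and f :: "(real ^ 'n) \<Rightarrow>\<^sub>C real"
    and b g :: "real ^ 'n \<Rightarrow> real"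
    and M :: "'w measure"
    and a :: "nat \<Rightarrow> 'w \<Rightarrow> real"
    and \<mu> :: "nat \<Rightarrow> (real ^ 'n) set \<Rightarrow> real"
    and \<mu>\<omega> :: "'w \<Rightarrow> (real ^ 'n) set \<Rightarrow> real"
  assumes "CARD('n) \<ge> 3" and "p > 1"
    and "open U" and "connected U" and "bounded U" and "U \<noteq> {}"
    and "prob_space M" and "complete_measure M"
    and "f \<noteq> 0"
    and "b \<in> linf_space U" and "\<not> (AE x in lebesgue_on U. b x = 0)"
    and "K = l0 U * p * linf_norm U b"
    and "g \<in> linf_space U"
    and "linf_norm U g < 1 / l0 U * (1 / (2 powr p * K)) powr (1 / (p - 1))"
    and "\<And>j. j \<ge> 1 \<Longrightarrow> \<mu> j \<in> radon_measures U"
    and "\<And>j. j \<ge> 1 \<Longrightarrow> a j \<in> borel_measurable M"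
    and "AE \<omega> in M. \<mu>\<omega> \<omega> \<in> radon_measures U \<and>
           (\<lambda>k. variation (\<lambda>A. partial_sum a \<mu> k \<omega> A - \<mu>\<omega> \<omega> A) U) \<longlonglongrightarrow> 0"
    and "0 < c" and "c < 1 / (l0 U * norm f)"
    and "summable (\<lambda>k. measure M {\<omega> \<in> space M. variation (partial_sum a \<mu> (Suc k) \<omega>) U \<ge> ennreal c})"
  shows "AE \<omega> in M. \<exists>u. integral_solution U p (potential U (apply_bcontfun f) (\<mu>\<omega> \<omega>)) b g u"
proof -
  interpret prob_space M by fact
  have n: "DIM(real ^ 'n) \<ge> 3" using assms(1) by simp
  note p = assms(2)
  note U = \<open>open U\<close> \<open>bounded U\<close>
  define L where "L = l0 U"
  have L: "L > 0"
    using diameter_pos_open[OF U \<open>U \<noteq> {}\<close>] assms(1) by (simp add: L_def l0_def)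
  have f: "norm f > 0" using \<open>f \<noteq> 0\<close> by simp
  define \<beta> where "\<beta> = linf_norm U b"
  have b: "b \<in> borel_measurable (lebesgue_on U)" "AE x in lebesgue_on U. \<bar>b x\<bar> \<le> \<beta>"
    using AE_abs_le_linf_norm[OF assms(10)] assms(10) by (auto simp: \<beta>_def linf_space_def)
  \<comment> \<open>Since \<open>b\<close> is not almost everywhere 0, \<open>K\<close> is positive
    and the quotient in the hypothesis on \<open>g\<close> does not degenerate to a division by
    0.\<close>
  have \<beta>: "\<beta> > 0"
  proof (rule ccontr)
    assume "\<not> \<beta> > 0"
    with b(2) have "AE x in lebesgue_on U. b x = 0" by (elim eventually_mono) auto
    with assms(11) show False by blast
  qed
  \<comment> \<open>The maximum with 0 gives a nonnegative bound outright; the upper bound assumed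
    for the norm is nonnegative, so it carries over to \<Gamma>.\<close>
  define \<Gamma> where "\<Gamma> = max 0 (linf_norm U g)"
  have g: "g \<in> borel_measurable (lebesgue_on U)" "AE x in lebesgue_on U. \<bar>g x\<bar> \<le> \<Gamma>" "\<Gamma> \<ge> 0"
    using AE_abs_le_linf_norm[OF assms(13)] assms(13)
    by (auto simp: \<Gamma>_def linf_space_def elim: eventually_mono)
  have K: "K = L * p * \<beta>" "K > 0" using assms(12) L \<beta> p by (simp_all add: L_def \<beta>_def)
  have small: "L * \<beta> * p * (2 * L * \<Gamma>) powr (p - 1) \<le> 1 / 2"
  proof -
    have "\<Gamma> \<le> 1 / L * (1 / (2 powr p * K)) powr (1 / (p - 1))"
      using assms(14) L by (simp add: \<Gamma>_def L_def)
    then have "L * \<Gamma> \<le> (1 / (2 powr p * K)) powr (1 / (p - 1))" using L by (simp add: field_simps)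
    then have "(L * \<Gamma>) powr (p - 1) \<le> ((1 / (2 powr p * K)) powr (1 / (p - 1))) powr (p - 1)"
      using p L g(3) by (intro powr_mono2) auto
    also have "\<dots> = 1 / (2 powr p * K)" using p K by (simp add: powr_powr)
    finally have 1: "(L * \<Gamma>) powr (p - 1) \<le> 1 / (2 powr p * K)" .
    have "L * \<beta> * p * (2 * L * \<Gamma>) powr (p - 1) = K * (2 powr (p - 1) * (L * \<Gamma>) powr (p - 1))"
      using L g(3) by (simp add: K mult_ac powr_mult[symmetric])
    also have "\<dots> \<le> K * (2 powr (p - 1) * (1 / (2 powr p * K)))"
      using 1 K by (intro mult_left_mono) auto
    also have "\<dots> = 1 / 2" using K(2) by (simp add: powr_diff)
    finally show ?thesis .
  qed
  have \<mu>v: "variation (\<mu> j) U < \<infinity>" if "j \<ge> 1" for j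
    using assms(15)[OF that] by (simp add: radon_measures_def)
  define A where "A k = {\<omega> \<in> space M. variation (partial_sum a \<mu> (Suc k) \<omega>) U \<ge> ennreal c}" for k
  have A: "A k \<in> sets M" for k
  proof -
    have [measurable]: "(\<lambda>\<omega>. variation (partial_sum a \<mu> (Suc k) \<omega>) U) \<in> borel_measurable M"
      by (rule borel_measurable_variation_partial_sum[OF assms(16) \<mu>v])
    show ?thesis unfolding A_def by measurable
  qed
  have "AE \<omega> in M. eventually (\<lambda>k. \<omega> \<in> space M - A k) sequentially"
    by (rule borel_cantelli_AE1[OF A]) (use assms(20) in \<open>auto simp: A_def less_top[symmetric]\<close>)
  with assms(17) show ?thesis
  proof eventually_elim
    case (elim \<omega>)
    let ?\<nu> = "\<mu>\<omega> \<omega>"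
    have \<nu>: "countably_additive_on U ?\<nu>" "variation ?\<nu> U < \<infinity>"
      using elim(1) by (auto simp: radon_measures_def)
    have "eventually (\<lambda>k. variation (partial_sum a \<mu> (Suc k) \<omega>) U \<le> ennreal c) sequentially"
      using elim(2) by (elim eventually_mono) (auto simp: A_def)
    then have v: "variation ?\<nu> U \<le> ennreal c"
      using variation_limit_le[of "\<lambda>k. partial_sum a \<mu> k \<omega>"] elim(1) by blast
    have Um: "U \<in> sets borel" using U by simp
    have fm: "apply_bcontfun f \<in> borel_measurable borel"
      by (intro borel_measurable_continuous_onI) auto
    show ?case
    proof (rule exists_integral_solution[OF n U p b _ g _ _ _ small[unfolded L_def]])
      show "potential U (apply_bcontfun f) ?\<nu> \<in> borel_measurable (lebesgue_on U)"
        using borel_measurable_potential[OF \<nu>(1) Um \<nu>(2) fm]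
        by (intro measurable_restrict_space1) (simp add: measurable_completion)
      show "\<bar>potential U (apply_bcontfun f) ?\<nu> x\<bar> \<le> norm f * c" for x
        using norm_bounded[of f] \<open>0 < c\<close> by (intro abs_potential_le[OF \<nu>(1) Um v]) auto
      \<comment> \<open>The bound on \<open>c\<close> enters here; \<open>norm f * c\<close> is the
        uniform bound for the potential.\<close>
      show "l0 U * (norm f * c) \<le> 1"
        using assms(19) L f by (simp add: L_def field_simps)
    qed (use \<beta> in auto)
  qed
qed

end
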